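(* Let $\lambda$ be an integer partition. Then $\lambda$ is $e$-positive (that is, $c_\lambda(G)\ge 0$ for every finite graph $G$ with $|\lambda|$ vertices, where $c_\lambda(G)$ is the coefficient of $e_\lambda$ in the expansion of the chromatic symmetric function $X(G)$ in the elementary symmetric basis) if and only if $\lambda$ is a hook partition (that is, $\lambda$ has at most one part larger than $1$).
   Context: Graphs are finite and simple. For a finite graph $G=(V,E)$, the chromatic symmetric function is the formal power series $X(G):=\sum_{\chi}\prod_{v\in V}x_{\chi(v)}\in\mathbb{Z}[[x_1,x_2,\ldots]]$, where $\chi$ ranges over all proper vertex colorings $\chi:V\to\{1,2,\ldots\}$ of $G$ (adjacent vertices receive different colors). It is a homogeneous symmetric function of degree $|V|$. For a positive integer $m$, $e_m:=\sum_{1\le i_1<\cdots<i_m}x_{i_1}\cdots x_{i_m}$. For an integer partition $\lambda=(\lambda_1,\ldots,\lambda_r)$ (weakly decreasing positive integers), $e_\lambda:=e_{\lambda_1}\cdots e_{\lambda_r}$. The size of $\lambda$ is $|\lambda|=\lambda_1+\cdots+\lambda_r$. The functions $e_\lambda$, for $\lambda$ ranging over the partitions of size $n$, form a basis of the homogeneous symmetric functions of degree $n$, so for every graph $G$ on $n$ vertices there are unique integers $c_\lambda(G)$ (for $\lambda$ of size $n$) with $X(G)=\sum_{\lambda}c_\lambda(G)e_\lambda$. A partition $\lambda$ is called $e$-positive if $c_\lambda(G)\ge 0$ for every graph $G$ (with $|\lambda|$ vertices). A hook partition is a partition with at most a single part larger than $1$. *)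

theory Defs
  imports
    "HOL-Library.Poly_Mapping"
    "HOL-Library.FuncSet"
    "Graph_Theory.Pair_Digraph"
begin

section \<open>Formal power series in countably many variables\<close>

text \<open>
  A monomial is its finitely supported exponent vector, and a formal power series is an arbitrary
  family of coefficients indexed by monomials. The variables are indexed by \<open>nat\<close> from \<open>0\<close>:
  index \<open>i\<close> stands for the variable \<open>x\<^sub>i\<^sub>+\<^sub>1\<close> (and colour \<open>i\<close> for colour \<open>i + 1\<close>).
\<close>

typedef 'a mfps = "UNIV :: ((nat \<Rightarrow>\<^sub>0 nat) \<Rightarrow> 'a) set"
  morphisms mfps_nth Abs_mfps
  by simp

setup_lifting type_definition_mfps

lemma mfps_eqI: "(\<And>m. mfps_nth f m = mfps_nth g m) \<Longrightarrow> f = g"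
  by transfer auto

lemma finite_monomial_splits:
  fixes m :: "nat \<Rightarrow>\<^sub>0 nat"
  shows "finite {(a, b). a + b = m}"
proof -
  let ?A = "{a. \<exists>b. a + b = m}"
  let ?h = "\<lambda>a. restrict (Poly_Mapping.lookup a) (Poly_Mapping.keys m)"
  have le: "Poly_Mapping.lookup a i \<le> Poly_Mapping.lookup m i" if "a \<in> ?A" for a i
    using that by (auto simp: lookup_add)
  have "?h ` ?A \<subseteq> (\<Pi>\<^sub>E i\<in>Poly_Mapping.keys m. {.. Poly_Mapping.lookup m i})"
    using le by auto
  moreover have "finite (\<Pi>\<^sub>E i\<in>Poly_Mapping.keys m. {.. Poly_Mapping.lookup m i})"
    by (intro finite_PiE) auto
  ultimately have "finite (?h ` ?A)"
    by (rule finite_subset)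
  moreover have "inj_on ?h ?A"
  proof (rule inj_onI)
    fix a b assume ab: "a \<in> ?A" "b \<in> ?A" "?h a = ?h b"
    show "a = b"
    proof (rule poly_mapping_eqI)
      fix i
      show "Poly_Mapping.lookup a i = Poly_Mapping.lookup b i"
      proof (cases "i \<in> Poly_Mapping.keys m")
        case True
        then show ?thesis using fun_cong[OF ab(3), of i] by simp
      next
        case False
        then show ?thesis using le[OF ab(1), of i] le[OF ab(2), of i]
          by (simp add: in_keys_iff)
      qed
    qed
  qed
  ultimately have fin: "finite ?A"
    by (rule finite_imageD)
  have "{(a, b). a + b = m} \<subseteq> (\<lambda>a. (a, m - a)) ` ?A"
    by auto
  then show ?thesis
    using fin finite_subset by blast
qed

instantiation mfps :: (comm_ring_1) comm_ring_1
begin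

lift_definition zero_mfps :: "'a mfps" is "\<lambda>m. 0" .

lift_definition one_mfps :: "'a mfps" is "\<lambda>m. if m = 0 then 1 else 0" .

lift_definition plus_mfps :: "'a mfps \<Rightarrow> 'a mfps \<Rightarrow> 'a mfps" is "\<lambda>f g m. f m + g m" .

lift_definition minus_mfps :: "'a mfps \<Rightarrow> 'a mfps \<Rightarrow> 'a mfps" is "\<lambda>f g m. f m - g m" .

lift_definition uminus_mfps :: "'a mfps \<Rightarrow> 'a mfps" is "\<lambda>f m. - f m" .

lift_definition times_mfps :: "'a mfps \<Rightarrow> 'a mfps \<Rightarrow> 'a mfps" is
  "\<lambda>f g m. \<Sum>(a, b) | a + b = m. f a * g b" .

instance
proof
  fix f g h :: "'a mfps"
  show "f + g + h = f + (g + h)" "f + g = g + f" "0 + f = f" "- f + f = 0" "f - g = f + - g"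
    by (transfer; simp add: add_ac)+
  show "(0 :: 'a mfps) \<noteq> 1"
    by transfer (metis zero_neq_one)
  show "f * g = g * f"
  proof (transfer, rule ext)
    fix f g :: "(nat \<Rightarrow>\<^sub>0 nat) \<Rightarrow> 'a" and m
    show "(\<Sum>(a, b) | a + b = m. f a * g b) = (\<Sum>(a, b) | a + b = m. g a * f b)"
      by (rule sum.reindex_bij_witness[where i = prod.swap and j = prod.swap])
        (auto simp: add.commute mult.commute)
  qed
  show "(f + g) * h = f * h + g * h"
    by transfer (simp add: distrib_right sum.distrib case_prod_unfold)
  show "1 * f = f"
  proof (transfer, rule ext)
    fix f :: "(nat \<Rightarrow>\<^sub>0 nat) \<Rightarrow> 'a" and m
    have "(\<Sum>(a, b) | a + b = m. (if a = 0 then 1 else 0) * f b)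
        = (\<Sum>(a, b)\<in>{(0 :: nat \<Rightarrow>\<^sub>0 nat, m)}. (if a = 0 then 1 else 0) * f b)"
      by (rule sum.mono_neutral_right[OF finite_monomial_splits]) (auto split: if_splits)
    then show "(\<Sum>(a, b) | a + b = m. (if a = 0 then 1 else 0) * f b) = f m"
      by simp
  qed
  show "f * g * h = f * (g * h)"
  proof (transfer, rule ext)
    fix f g h :: "(nat \<Rightarrow>\<^sub>0 nat) \<Rightarrow> 'a" and m :: "nat \<Rightarrow>\<^sub>0 nat"
    have fin: "\<forall>x\<in>{(a, b). a + b = m}. finite {(c, d). c + d = fst x}"
      "\<forall>x\<in>{(a, b). a + b = m}. finite {(c, d). c + d = snd x}"
      using finite_monomial_splits by auto
    have "(\<Sum>(a, b) | a + b = m. (\<Sum>(c, d) | c + d = a. f c * g d) * h b)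
        = (\<Sum>x | fst x + snd x = m. \<Sum>y | fst y + snd y = fst x. f (fst y) * g (snd y) * h (snd x))"
      by (simp add: sum_distrib_right case_prod_unfold)
    also have "\<dots> = (\<Sum>(x, y)\<in>(SIGMA x:{x. fst x + snd x = m}. {y. fst y + snd y = fst x}).
        f (fst y) * g (snd y) * h (snd x))"
      using fin finite_monomial_splits[of m]
      by (intro sum.Sigma) (auto simp: case_prod_unfold)
    also have "\<dots> = (\<Sum>(x, y)\<in>(SIGMA x:{x. fst x + snd x = m}. {y. fst y + snd y = snd x}).
        f (fst x) * (g (fst y) * h (snd y)))"
      by (rule sum.reindex_bij_witness[where
            i = "\<lambda>(x, y). ((fst x + fst y, snd y), (fst x, fst y))" and
            j = "\<lambda>(x, y). ((fst y, snd y + snd x), (snd y, snd x))"])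
        (auto simp: add_ac mult_ac)
    also have "\<dots> = (\<Sum>x | fst x + snd x = m. \<Sum>y | fst y + snd y = snd x.
        f (fst x) * (g (fst y) * h (snd y)))"
      using fin finite_monomial_splits[of m]
      by (intro sum.Sigma[symmetric]) (auto simp: case_prod_unfold)
    also have "\<dots> = (\<Sum>(a, b) | a + b = m. f a * (\<Sum>(c, d) | c + d = b. g c * h d))"
      by (simp add: sum_distrib_left case_prod_unfold)
    finally show "(\<Sum>(a, b) | a + b = m. (\<Sum>(c, d) | c + d = a. f c * g d) * h b)
        = (\<Sum>(a, b) | a + b = m. f a * (\<Sum>(c, d) | c + d = b. g c * h d))" .
  qed
qed

end

text \<open>
  The formal sum of the monomials with exponent vectors \<open>w a\<close> for \<open>a \<in> A\<close>. It is meaningful only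
  when every monomial occurs finitely often, which is checked below for both uses.
\<close>

definition monomial_series :: "'b set \<Rightarrow> ('b \<Rightarrow> (nat \<Rightarrow>\<^sub>0 nat)) \<Rightarrow> int mfps" where
  "monomial_series A w = Abs_mfps (\<lambda>m. int (card {a \<in> A. w a = m}))"

lemma mfps_nth_monomial_series:
  "mfps_nth (monomial_series A w) m = int (card {a \<in> A. w a = m})"
  by (simp add: monomial_series_def Abs_mfps_inverse)

lemma lookup_sum_single:
  "finite V \<Longrightarrow> Poly_Mapping.lookup (\<Sum>v\<in>V. Poly_Mapping.single (\<chi> v) (1 :: nat)) i = card {v \<in> V. \<chi> v = i}"
  by (simp add: lookup_sum lookup_single when_def sum.If_cases Int_def)


section \<open>Chromatic symmetric functions\<close>

text \<open>
  Finite simple graphs are the symmetric loop-free digraphs \<open>pair_graph\<close>. Colourings are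
  extensional, so that distinct elements of this set differ on a vertex.
\<close>

definition proper_colourings :: "'v pair_pre_digraph \<Rightarrow> ('v \<Rightarrow> nat) set" where
  "proper_colourings G =
     {\<chi> \<in> pverts G \<rightarrow>\<^sub>E UNIV. \<forall>(u, v) \<in> parcs G. \<chi> u \<noteq> \<chi> v}"

definition chromatic_sf :: "'v pair_pre_digraph \<Rightarrow> int mfps" where
  "chromatic_sf G =
     monomial_series (proper_colourings G) (\<lambda>\<chi>. \<Sum>v\<in>pverts G. Poly_Mapping.single (\<chi> v) 1)"

lemma finite_colourings_with_monomial:
  assumes "pair_graph G"
  shows "finite {\<chi> \<in> proper_colourings G. (\<Sum>v\<in>pverts G. Poly_Mapping.single (\<chi> v) (1 :: nat)) = m}"
proof -
  have fin: "finite (pverts G)"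
    using assms by (simp add: pair_graph_def pair_digraph_def pair_fin_digraph_def
        pair_fin_digraph_axioms_def)
  have "\<chi> v \<in> Poly_Mapping.keys m"
    if "(\<Sum>v\<in>pverts G. Poly_Mapping.single (\<chi> v) (1 :: nat)) = m" "v \<in> pverts G" for \<chi> v
  proof -
    have "Poly_Mapping.lookup m (\<chi> v) = card {u \<in> pverts G. \<chi> u = \<chi> v}"
      using lookup_sum_single[OF fin, of \<chi> "\<chi> v"] that(1) by simp
    moreover have "card {u \<in> pverts G. \<chi> u = \<chi> v} > 0"
      using fin that(2) by (auto simp: card_gt_0_iff)
    ultimately show ?thesis
      by (simp add: in_keys_iff)
  qed
  then have "{\<chi> \<in> proper_colourings G. (\<Sum>v\<in>pverts G. Poly_Mapping.single (\<chi> v) 1) = m}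
      \<subseteq> (pverts G \<rightarrow>\<^sub>E Poly_Mapping.keys m)"
    unfolding proper_colourings_def by blast
  moreover have "finite (pverts G \<rightarrow>\<^sub>E Poly_Mapping.keys m)"
    using fin by (intro finite_PiE) auto
  ultimately show ?thesis
    by (rule finite_subset)
qed


section \<open>Elementary symmetric functions\<close>

definition esym :: "nat \<Rightarrow> int mfps" where
  "esym k = monomial_series {S. finite S \<and> card S = k} (\<lambda>S. \<Sum>i\<in>S. Poly_Mapping.single i 1)"

lemma finite_sets_with_monomial:
  "finite {S \<in> {S. finite S \<and> card S = k}. (\<Sum>i\<in>S. Poly_Mapping.single i (1 :: nat)) = m}"
proof -
  have "S \<subseteq> Poly_Mapping.keys m" if "finite S" "(\<Sum>i\<in>S. Poly_Mapping.single i (1 :: nat)) = m" for S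
  proof
    fix i assume "i \<in> S"
    then have "{v \<in> S. v = i} = {i}" by auto
    then show "i \<in> Poly_Mapping.keys m"
      using lookup_sum_single[OF that(1), of "\<lambda>i. i" i] that(2) by (simp add: in_keys_iff)
  qed
  then have "{S \<in> {S. finite S \<and> card S = k}. (\<Sum>i\<in>S. Poly_Mapping.single i 1) = m} \<subseteq> Pow (Poly_Mapping.keys m)"
    by blast
  then show ?thesis
    by (rule finite_subset) simp
qed

definition is_partition :: "nat list \<Rightarrow> bool" where
  "is_partition p \<longleftrightarrow> sorted_wrt (\<ge>) p \<and> (\<forall>k\<in>set p. k > 0)"

definition partitions_of :: "nat \<Rightarrow> nat list set" where
  "partitions_of n = {p. is_partition p \<and> sum_list p = n}"

lemma finite_partitions_of: "finite (partitions_of n)"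
proof -
  have len: "length p \<le> sum_list p" if "\<forall>k\<in>set p. k > 0" for p :: "nat list"
    using that by (induction p) auto
  have "partitions_of n \<subseteq> {p. set p \<subseteq> {..n} \<and> length p \<le> n}"
    using len member_le_sum_list by (fastforce simp: partitions_of_def is_partition_def)
  then show ?thesis
    by (rule finite_subset) (simp add: finite_lists_length_le)
qed

definition esym_partition :: "nat list \<Rightarrow> int mfps" where
  "esym_partition p = prod_list (map esym p)"


section \<open>Coefficients in the elementary basis\<close>

definition is_e_expansion :: "nat \<Rightarrow> int mfps \<Rightarrow> (nat list \<Rightarrow> int) \<Rightarrow> bool" where
  "is_e_expansion n F c \<longleftrightarrow>
     (\<forall>p. p \<notin> partitions_of n \<longrightarrow> c p = 0) \<and>
     F = (\<Sum>p\<in>partitions_of n. of_int (c p) * esym_partition p)"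

text \<open>
  The description is proper by the fundamental theorem of symmetric functions; restricting \<open>c\<close> to
  vanish off the partitions of \<open>n\<close> only serves to make it unique as a total function.
\<close>

definition e_coeff :: "'v pair_pre_digraph \<Rightarrow> nat list \<Rightarrow> int" where
  "e_coeff G = (THE c. is_e_expansion (card (pverts G)) (chromatic_sf G) c)"

text \<open>
  HOL definitions cannot quantify over all vertex types, so the graphs here have natural numbers as
  vertices. By \<open>e_positive_any_vertex_type\<close> below this is no restriction.
\<close>

definition e_positive :: "nat list \<Rightarrow> bool" where
  "e_positive p \<longleftrightarrow>
     (\<forall>G :: nat pair_pre_digraph. pair_graph G \<and> card (pverts G) = sum_list p \<longrightarrow> e_coeff G p \<ge> 0)"

definition is_hook :: "nat list \<Rightarrow> bool" where
  "is_hook p \<longleftrightarrow> length (filter (\<lambda>k. k > 1) p) \<le> 1"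

lemma pair_graph_iff:
  "pair_graph G \<longleftrightarrow> finite (pverts G) \<and> parcs G \<subseteq> pverts G \<times> pverts G \<and> sym (parcs G) \<and> irrefl (parcs G)"
proof
  assume "pair_graph G"
  then interpret pair_graph G .
  show "finite (pverts G) \<and> parcs G \<subseteq> pverts G \<times> pverts G \<and> sym (parcs G) \<and> irrefl (parcs G)"
    using pair_finite_verts arc_fst_in_verts arc_snd_in_verts pair_sym_arcs pair_no_loops
    by (fastforce simp: symmetric_def irrefl_def)
next
  assume *: "finite (pverts G) \<and> parcs G \<subseteq> pverts G \<times> pverts G \<and> sym (parcs G) \<and> irrefl (parcs G)"
  moreover have "finite (parcs G)"
    using * by (meson finite_SigmaI finite_subset)
  ultimately show "pair_graph G"
    by unfold_locales (auto simp: symmetric_def irrefl_def)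
qed

lemma e_positive_any_vertex_type:
  fixes G :: "'v pair_pre_digraph"
  assumes "e_positive p" "pair_graph G" "card (pverts G) = sum_list p"
  shows "e_coeff G p \<ge> 0"
proof -
  have fin: "finite (pverts G)" and sub: "parcs G \<subseteq> pverts G \<times> pverts G"
    and sy: "sym (parcs G)" and irr: "irrefl (parcs G)"
    using assms(2) by (auto simp: pair_graph_iff)
  obtain h where h: "bij_betw h (pverts G) {0..<card (pverts G)}"
    using ex_bij_betw_finite_nat[OF fin] by blast
  define H where "H = \<lparr>pverts = h ` pverts G, parcs = map_prod h h ` parcs G\<rparr>"
  have inj: "inj_on h (pverts G)" and "card (pverts H) = card (pverts G)"
    using h by (auto simp: bij_betw_def H_def card_image)
  have "pair_graph H"
    unfolding pair_graph_iff
  proof (intro conjI)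
    show "finite (pverts H)" "parcs H \<subseteq> pverts H \<times> pverts H" "sym (parcs H)"
      using fin sub sy by (auto simp: H_def sym_def)
    show "irrefl (parcs H)"
    proof (rule irreflI, rule notI)
      fix x assume "(x, x) \<in> parcs H"
      then obtain u v where "(u, v) \<in> parcs G" "h u = h v" by (auto simp: H_def)
      then show False using sub inj irr by (metis SigmaE2 inj_onD irreflD subsetD)
    qed
  qed
  have "chromatic_sf H = chromatic_sf G"
  proof (rule mfps_eqI)
    fix m
    let ?w = "\<lambda>V \<chi>. \<Sum>v\<in>V. Poly_Mapping.single (\<chi> v) (1 :: nat)"
    let ?i = "inv_into (pverts G) h"
    have w: "?w (h ` pverts G) \<chi> = ?w (pverts G) (\<lambda>v. \<chi> (h v))" for \<chi> :: "nat \<Rightarrow> nat"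
      by (simp add: sum.reindex[OF inj])
    have inv: "?i (h v) = v" if "v \<in> pverts G" for v
      using inj that by simp
    have "bij_betw (\<lambda>\<chi>. restrict (\<lambda>v. \<chi> (h v)) (pverts G))
        {\<chi> \<in> proper_colourings H. ?w (pverts H) \<chi> = m}
        {\<chi> \<in> proper_colourings G. ?w (pverts G) \<chi> = m}"
    proof (rule bij_betw_byWitness[where f' = "\<lambda>\<chi>. restrict (\<lambda>v. \<chi> (?i v)) (h ` pverts G)"])
      show "\<forall>\<chi>\<in>{\<chi> \<in> proper_colourings H. ?w (pverts H) \<chi> = m}.
          restrict (\<lambda>v. restrict (\<lambda>v. \<chi> (h v)) (pverts G) (?i v)) (h ` pverts G) = \<chi>"
        by (auto simp: proper_colourings_def H_def fun_eq_iff inv PiE_def extensional_def)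
      show "\<forall>\<chi>\<in>{\<chi> \<in> proper_colourings G. ?w (pverts G) \<chi> = m}.
          restrict (\<lambda>v. restrict (\<lambda>v. \<chi> (?i v)) (h ` pverts G) (h v)) (pverts G) = \<chi>"
        by (auto simp: proper_colourings_def fun_eq_iff inv PiE_def extensional_def)
      show "(\<lambda>\<chi>. restrict (\<lambda>v. \<chi> (h v)) (pverts G)) ` {\<chi> \<in> proper_colourings H. ?w (pverts H) \<chi> = m}
          \<subseteq> {\<chi> \<in> proper_colourings G. ?w (pverts G) \<chi> = m}"
      proof (rule image_subsetI)
        fix \<chi> assume \<chi>: "\<chi> \<in> {\<chi> \<in> proper_colourings H. ?w (pverts H) \<chi> = m}"
        then have "\<chi> (h u) \<noteq> \<chi> (h v)" if "(u, v) \<in> parcs G" for u v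
          using that by (force simp: proper_colourings_def H_def)
        moreover have "u \<in> pverts G" "v \<in> pverts G" if "(u, v) \<in> parcs G" for u v
          using that sub by auto
        moreover have "?w (pverts G) (restrict (\<lambda>v. \<chi> (h v)) (pverts G)) = m"
          using \<chi> w[of \<chi>] by (simp add: H_def cong: sum.cong)
        ultimately show "restrict (\<lambda>v. \<chi> (h v)) (pverts G)
            \<in> {\<chi> \<in> proper_colourings G. ?w (pverts G) \<chi> = m}"
          by (fastforce simp: proper_colourings_def)
      qed
      show "(\<lambda>\<chi>. restrict (\<lambda>v. \<chi> (?i v)) (h ` pverts G)) ` {\<chi> \<in> proper_colourings G. ?w (pverts G) \<chi> = m}
          \<subseteq> {\<chi> \<in> proper_colourings H. ?w (pverts H) \<chi> = m}"
      proof (rule image_subsetI)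
        fix \<chi> assume \<chi>: "\<chi> \<in> {\<chi> \<in> proper_colourings G. ?w (pverts G) \<chi> = m}"
        let ?\<psi> = "restrict (\<lambda>v. \<chi> (?i v)) (h ` pverts G)"
        have \<psi>: "?\<psi> (h v) = \<chi> v" if "v \<in> pverts G" for v
          using that inv by simp
        have "?w (h ` pverts G) ?\<psi> = ?w (pverts G) \<chi>"
          unfolding w using \<psi> by (intro sum.cong) auto
        moreover have "?\<psi> (h u) \<noteq> ?\<psi> (h v)" if "(u, v) \<in> parcs G" for u v
        proof -
          have "u \<in> pverts G" "v \<in> pverts G" "\<chi> u \<noteq> \<chi> v"
            using that sub \<chi> by (auto simp: proper_colourings_def)
          then show ?thesis using \<psi> by metis
        qed
        moreover have "?\<psi> \<in> h ` pverts G \<rightarrow>\<^sub>E UNIV"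
          by simp
        ultimately show "?\<psi> \<in> {\<chi> \<in> proper_colourings H. ?w (pverts H) \<chi> = m}"
          using \<chi> unfolding proper_colourings_def H_def by clarsimp metis
      qed
    qed
    then show "mfps_nth (chromatic_sf H) m = mfps_nth (chromatic_sf G) m"
      by (simp add: chromatic_sf_def mfps_nth_monomial_series bij_betw_same_card)
  qed
  then have "e_coeff H = e_coeff G"
    using \<open>card (pverts H) = card (pverts G)\<close> by (simp add: e_coeff_def)
  then show ?thesis
    using assms \<open>pair_graph H\<close> \<open>card (pverts H) = card (pverts G)\<close> by (metis e_positive_def)
qed

end

(*
  Induct on the graph: conditioning on the set W of vertices that share the colour of a fixed vertex v
  by inclusion-exclusion, X(V) is the sum over W containing v of c(W) p_|W| X(V - W), where c is the
  logarithm of the indicator function of independent sets. Here (-1)^(|W| - 1) c(W) is the number of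
  acyclic orientations of W with unique sink v.

  Hooks: the coefficients of the hooks (k, 1, ..., 1) in a product of symmetric functions obey a
  Leibniz rule, so the coefficient in X(V) is an alternating sum, over vertices v and independent sets
  I with |I| at most |V| - k, of the numbers of orientations of V - I with unique sink v. Turning the
  vertices of I into sources groups these terms by the source set J of an orientation of V. Each J
  contributes a truncated alternating sum over its subsets I, which is non-negative as J is nonempty.

  Non-hooks: for a, b > 1 the only contribution to the coefficient of e_a e_b for the star on a + b
  vertices comes from the power sum p_(a+b), and it is negative. A disjoint clique on m vertices
  multiplies X by m! e_m, which supplies the remaining parts.
*)

theory Submission
  imports Defs "HOL-Computational_Algebra.Polynomial"
begin

section \<open>Logarithms of set functions\<close>

text \<open>Elementary coefficients are not visible in a power series, so X is lifted to a
  polynomial \<open>cpoly\<close> in abstract generators; evaluation at \<open>esym\<close> is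
  injective in each degree. Coefficients are then read through ring homomorphisms to Z[x]: e_1 to 1
  and e_k to x modulo x^2 for hooks, e_a and e_b to x with x^2 read off for stars. Homomorphisms
  respect the recursion for X, so only the images of the power sums are needed, and Newton's
  identities supply them over the integers.

  The logarithm belongs to the algebra of set functions with product sum over W of g(W) f(V - W).
  Rooting it at a vertex gives a recursion without denominators. Independence of the root matters
  later: e_k e_1^(n-k) has coefficient (-1)^(k+1) n in p_n, and with n = |W| the factor |W| becomes
  a choice of sink in W.

  Orientations guide the proof but are never formalised. Deleting a set I of sources can be undone
  only if no vertex of I is isolated, hence the separate treatment of isolated vertices. The number
  of orientations with source set exactly J appears as a Moebius inversion, whose non-negativity is
  shown by induction on V.\<close>

function slog :: "('v set \<Rightarrow> int) \<Rightarrow> 'v \<Rightarrow> 'v set \<Rightarrow> int" where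
  "slog f v V =
     (if finite V then f V - (\<Sum>W\<in>{W. v \<in> W \<and> W \<subset> V}. slog f v W * f (V - W)) else 0)"
  by pat_completeness auto
termination
  by (relation "measure (\<lambda>(f, v, V). card V)") (auto simp: psubset_card_mono)

declare slog.simps [simp del]

text \<open>The derivative at \<open>v\<close> of f = exp g, that is f' = g' f. With
  \<open>f {} = 1\<close>, the term W = V is \<open>slog f v V\<close> itself.\<close>

lemma slog_rec:
  assumes "finite V" "v \<in> V" "f {} = 1"
  shows "f V = (\<Sum>W | v \<in> W \<and> W \<subseteq> V. slog f v W * f (V - W))"
proof -
  have "{W. v \<in> W \<and> W \<subseteq> V} = insert V {W. v \<in> W \<and> W \<subset> V}"
    using assms by auto
  moreover have "finite {W. v \<in> W \<and> W \<subset> V}"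
    using assms(1) by (auto intro: finite_subset[of _ "Pow V"])
  ultimately show ?thesis
    using assms by (simp add: slog.simps[of f v V])
qed

text \<open>Split W by whether it contains the other root. Sets with both roots agree by induction;
  for the others, expanding \<open>f (V - W)\<close> at the other root gives a double sum over
  disjoint W, W' that is symmetric in the two roots.\<close>

lemma slog_root:
  assumes "finite V" "u \<in> V" "v \<in> V" "f {} = 1"
  shows "slog f u V = slog f v V"
  using assms(1-3)
proof (induction V rule: finite_psubset_induct)
  case (psubset V)
  let ?D = "\<lambda>x y. {W. x \<in> W \<and> y \<notin> W \<and> W \<subseteq> V}"
  let ?S = "\<lambda>x y. SIGMA W:?D x y. {W'. y \<in> W' \<and> W' \<subseteq> V - W}"
  have fin: "finite {W. Q W \<and> W \<subset> V}" "finite {W. Q W \<and> W \<subseteq> V}" for Q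
    using \<open>finite V\<close> by (auto intro: finite_subset[of _ "Pow V"])
  have finD: "finite (?D x y)" for x y
    using \<open>finite V\<close> by (auto intro: finite_subset[of _ "Pow V"])
  have one: "slog f x V = f V - (\<Sum>W | (x \<in> W \<and> y \<in> W) \<and> W \<subset> V. slog f x W * f (V - W))
      - (\<Sum>(W, W')\<in>?S x y. slog f x W * slog f y W' * f (V - W - W'))"
    if "x \<in> V" "y \<in> V" for x y
  proof -
    have "{W. x \<in> W \<and> W \<subset> V} = {W. (x \<in> W \<and> y \<in> W) \<and> W \<subset> V} \<union> ?D x y"
      using that by auto
    then have "(\<Sum>W | x \<in> W \<and> W \<subset> V. slog f x W * f (V - W)) =
       (\<Sum>W | (x \<in> W \<and> y \<in> W) \<and> W \<subset> V. slog f x W * f (V - W)) + (\<Sum>W\<in>?D x y. slog f x W * f (V - W))"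
      using fin finD by (simp only:) (rule sum.union_disjoint, auto)
    moreover have "(\<Sum>W\<in>?D x y. slog f x W * f (V - W)) =
       (\<Sum>W\<in>?D x y. \<Sum>W' | y \<in> W' \<and> W' \<subseteq> V - W. slog f x W * slog f y W' * f (V - W - W'))"
    proof (rule sum.cong[OF refl])
      fix W assume "W \<in> ?D x y"
      then have "f (V - W) = (\<Sum>W' | y \<in> W' \<and> W' \<subseteq> V - W. slog f y W' * f (V - W - W'))"
        using that assms(4) \<open>finite V\<close> by (intro slog_rec) auto
      then show "slog f x W * f (V - W) =
          (\<Sum>W' | y \<in> W' \<and> W' \<subseteq> V - W. slog f x W * slog f y W' * f (V - W - W'))"
        by (simp add: sum_distrib_left mult.assoc)
    qed
    moreover have "\<dots> = (\<Sum>(W, W')\<in>?S x y. slog f x W * slog f y W' * f (V - W - W'))"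
      using \<open>finite V\<close> finD by (intro sum.Sigma) auto
    ultimately show ?thesis
      using \<open>finite V\<close> by (simp add: slog.simps[of f x V])
  qed
  have "(\<Sum>(W, W')\<in>?S u v. slog f u W * slog f v W' * f (V - W - W')) =
      (\<Sum>(W, W')\<in>?S v u. slog f v W * slog f u W' * f (V - W - W'))"
    by (rule sum.reindex_bij_witness[where i = prod.swap and j = prod.swap])
      (auto simp: mult.commute Diff_eq Int_ac)
  moreover have "(\<Sum>W | (u \<in> W \<and> v \<in> W) \<and> W \<subset> V. slog f u W * f (V - W)) =
      (\<Sum>W | (v \<in> W \<and> u \<in> W) \<and> W \<subset> V. slog f v W * f (V - W))"
    using psubset.IH by (intro sum.cong) auto
  ultimately show ?case
    using one[of u v] one[of v u] psubset.prems by simp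
qed

definition slog0 :: "('v set \<Rightarrow> int) \<Rightarrow> 'v set \<Rightarrow> int" where
  "slog0 f W = slog f (SOME v. v \<in> W) W"

lemma slog0_eq: "finite W \<Longrightarrow> v \<in> W \<Longrightarrow> f {} = 1 \<Longrightarrow> slog0 f W = slog f v W"
  unfolding slog0_def by (rule slog_root) (auto intro: someI)

lemma slog0_rec:
  assumes "finite V" "v \<in> V" "f {} = 1"
  shows "f V = (\<Sum>W | v \<in> W \<and> W \<subseteq> V. slog0 f W * f (V - W))"
proof -
  have "slog0 f W = slog f v W" if "v \<in> W" "W \<subseteq> V" for W
    using that assms finite_subset by (intro slog0_eq) auto
  then show ?thesis
    using slog_rec[of V v f] assms by (auto intro!: sum.cong)
qed

text \<open>With eps^2 = 0 and f = exp g, one has f + eps G = exp (g + eps g h); this is the part of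
  its rooted recursion linear in eps. The Leibniz rule for hook coefficients produces the same
  recursion, so G is its closed form.\<close>

lemma slog0_derivation:
  fixes f h :: "'v set \<Rightarrow> int"
  defines "G \<equiv> \<lambda>V. \<Sum>W\<in>Pow V - {{}}. slog0 f W * h W * f (V - W)"
  assumes "finite V" "v \<in> V" "f {} = 1"
  shows "G V = (\<Sum>W | v \<in> W \<and> W \<subseteq> V. slog0 f W * (h W * f (V - W) + G (V - W)))"
proof -
  let ?A = "{W. v \<in> W \<and> W \<subseteq> V}" and ?B = "{W. v \<notin> W \<and> W \<subseteq> V \<and> W \<noteq> {}}"
  have fin: "finite ?A" "finite ?B"
    using \<open>finite V\<close> by (auto intro: finite_subset[of _ "Pow V"])
  have "Pow V - {{}} = ?A \<union> ?B"
    by auto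
  then have "G V = (\<Sum>W\<in>?A. slog0 f W * h W * f (V - W)) + (\<Sum>W\<in>?B. slog0 f W * h W * f (V - W))"
    unfolding G_def using fin by (simp only:) (rule sum.union_disjoint, auto)
  moreover have "(\<Sum>W\<in>?B. slog0 f W * h W * f (V - W)) =
      (\<Sum>W\<in>?B. \<Sum>U | v \<in> U \<and> U \<subseteq> V - W. slog0 f W * h W * (slog0 f U * f (V - W - U)))"
  proof (rule sum.cong[OF refl])
    fix W assume "W \<in> ?B"
    then have "f (V - W) = (\<Sum>U | v \<in> U \<and> U \<subseteq> V - W. slog0 f U * f (V - W - U))"
      using assms by (intro slog0_rec) auto
    then show "slog0 f W * h W * f (V - W) =
        (\<Sum>U | v \<in> U \<and> U \<subseteq> V - W. slog0 f W * h W * (slog0 f U * f (V - W - U)))"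
      by (simp add: sum_distrib_left)
  qed
  moreover have "\<dots> = (\<Sum>(W, U)\<in>(SIGMA W:?B. {U. v \<in> U \<and> U \<subseteq> V - W}).
      slog0 f W * h W * (slog0 f U * f (V - W - U)))"
    using \<open>finite V\<close> fin by (intro sum.Sigma) auto
  moreover have "\<dots> = (\<Sum>(U, W)\<in>(SIGMA U:?A. Pow (V - U) - {{}}).
      slog0 f U * (slog0 f W * h W * f (V - U - W)))"
    by (rule sum.reindex_bij_witness[where i = prod.swap and j = prod.swap])
      (auto simp: mult_ac Diff_eq Int_ac)
  moreover have "\<dots> = (\<Sum>U\<in>?A. \<Sum>W\<in>Pow (V - U) - {{}}. slog0 f U * (slog0 f W * h W * f (V - U - W)))"
    using \<open>finite V\<close> fin by (intro sum.Sigma[symmetric]) auto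
  moreover have "\<dots> = (\<Sum>U\<in>?A. slog0 f U * G (V - U))"
    by (simp add: G_def sum_distrib_left)
  ultimately show ?thesis
    by (simp add: distrib_left sum.distrib mult.assoc)
qed


section \<open>Alternating sums over subsets\<close>

lemma sum_Pow_insert:
  fixes F :: "'a set \<Rightarrow> 'b :: comm_monoid_add"
  assumes "finite T" "x \<notin> T"
  shows "(\<Sum>I\<in>Pow (insert x T). F I) = (\<Sum>I\<in>Pow T. F I) + (\<Sum>I\<in>Pow T. F (insert x I))"
proof -
  have "(\<Sum>I\<in>Pow (insert x T). F I) = (\<Sum>I\<in>Pow T. F I) + (\<Sum>I\<in>insert x ` Pow T. F I)"
    unfolding Pow_insert using assms by (intro sum.union_disjoint) auto
  moreover have "inj_on (insert x) (Pow T)"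
    using assms by (auto simp: inj_on_def)
  ultimately show ?thesis
    by (simp add: sum.reindex)
qed

lemma sum_Pow_alternating:
  "finite J \<Longrightarrow> (\<Sum>I\<in>Pow J. (- 1) ^ card I) = (of_bool (J = {}) :: int)"
proof (induction J rule: finite_induct)
  case (insert x J)
  have "(\<Sum>I\<in>Pow J. (- 1) ^ card (insert x I)) = (\<Sum>I\<in>Pow J. - ((- 1) ^ card I) :: int)"
    using insert.hyps by (intro sum.cong) (auto simp: card_insert_if finite_subset)
  then show ?case
    using insert.hyps by (simp add: sum_Pow_insert sum_negf)
qed simp

text \<open>Toggling a fixed element of J pairs consecutive weights, which cancel except at size m.
  What remains is the number of m-subsets of J without that element.\<close>

lemma sum_Pow_alternating_truncated:
  fixes m :: nat
  assumes "finite J" "J \<noteq> {}"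
  shows "0 \<le> (\<Sum>I\<in>Pow J. if card I \<le> m then (- 1) ^ (m - card I) else 0 :: int)"
proof -
  obtain x J' where J: "J = insert x J'" "x \<notin> J'"
    using assms(2) by (metis ex_in_conv mk_disjoint_insert)
  then have fin: "finite J'"
    using assms(1) by simp
  let ?t = "\<lambda>i. if i \<le> m then (- 1) ^ (m - i) else 0 :: int"
  have "?t i + ?t (Suc i) = of_bool (i = m)" for i
    by (cases "i < m") (auto simp: Suc_diff_Suc[symmetric])
  moreover have "card (insert x I) = Suc (card I)" if "I \<in> Pow J'" for I
    using that J fin by (auto simp: card_insert_if finite_subset)
  ultimately have "?t (card I) + ?t (card (insert x I)) = of_bool (card I = m)" if "I \<in> Pow J'" for I
    using that by (simp only:)
  then have "(\<Sum>I\<in>Pow J. ?t (card I)) = (\<Sum>I\<in>Pow J'. of_bool (card I = m))"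
    unfolding J(1) sum_Pow_insert[OF fin J(2)] sum.distrib[symmetric] by (intro sum.cong refl)
  then show ?thesis
    by (simp add: sum_nonneg)
qed

text \<open>Think of \<open>g I\<close> as the number of objects whose source set contains I. The
  alternating sum over K then counts those with source set exactly J, and such an object is counted
  on the left with weight \<open>w I\<close> for every I inside J.\<close>

lemma sum_Pow_moebius:
  fixes w g :: "'a set \<Rightarrow> int"
  assumes "finite T"
  shows "(\<Sum>I\<in>Pow T. w I * g I) =
    (\<Sum>J\<in>Pow T. (\<Sum>I\<in>Pow J. w I) * (\<Sum>K\<in>Pow (T - J). (- 1) ^ card K * g (J \<union> K)))"
  using assms
proof (induction T arbitrary: w g rule: finite_induct)
  case (insert x T)
  let ?b = "\<lambda>g J. \<Sum>K\<in>Pow (T - J). (- 1) ^ card K * g (J \<union> K)"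
  let ?gx = "\<lambda>I. g (insert x I)"
  have out: "(\<Sum>K\<in>Pow (insert x T - J). (- 1) ^ card K * g (J \<union> K)) = ?b g J - ?b ?gx J"
    if "J \<in> Pow T" for J
  proof -
    have eq: "insert x T - J = insert x (T - J)" and fin: "finite (T - J)" and nin: "x \<notin> T - J"
      using that insert.hyps by auto
    have "(\<Sum>K\<in>Pow (T - J). (- 1) ^ card (insert x K) * g (J \<union> insert x K)) =
        (\<Sum>K\<in>Pow (T - J). - ((- 1) ^ card K * ?gx (J \<union> K)))"
      using insert.hyps by (intro sum.cong) (auto simp: card_insert_if finite_subset)
    then show ?thesis
      unfolding eq sum_Pow_insert[OF fin nin] by (simp add: sum_negf)
  qed
  have ins: "(\<Sum>I\<in>Pow (insert x J). w I) * (\<Sum>K\<in>Pow (insert x T - insert x J). (- 1) ^ card K * g (insert x J \<union> K)) =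
      ((\<Sum>I\<in>Pow J. w I) + (\<Sum>I\<in>Pow J. w (insert x I))) * ?b ?gx J"
    if "J \<in> Pow T" for J
  proof -
    have "finite J" "x \<notin> J" "insert x T - insert x J = T - J"
      using that insert.hyps by (auto intro: finite_subset)
    then show ?thesis
      by (simp add: sum_Pow_insert)
  qed
  show ?case
    unfolding sum_Pow_insert[OF insert.hyps] insert.IH[of w g] insert.IH[of "\<lambda>I. w (insert x I)" ?gx]
      sum.distrib[symmetric]
  proof (rule sum.cong[OF refl])
    fix J assume J: "J \<in> Pow T"
    show "(\<Sum>I\<in>Pow J. w I) * ?b g J + (\<Sum>I\<in>Pow J. w (insert x I)) * ?b ?gx J =
        (\<Sum>I\<in>Pow J. w I) * (\<Sum>K\<in>Pow (insert x T - J). (- 1) ^ card K * g (J \<union> K)) +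
        (\<Sum>I\<in>Pow (insert x J). w I) *
          (\<Sum>K\<in>Pow (insert x T - insert x J). (- 1) ^ card K * g (insert x J \<union> K))"
      unfolding out[OF J] ins[OF J] by (simp only: ring_distribs)
  qed
qed simp


section \<open>Independent sets\<close>

context
  fixes E :: "('v \<times> 'v) set"
begin

definition ind :: "'v set \<Rightarrow> int" where
  "ind A = of_bool (\<forall>u\<in>A. \<forall>w\<in>A. (u, w) \<notin> E)"

definition isolated :: "'v \<Rightarrow> 'v set \<Rightarrow> bool" where
  "isolated x A \<longleftrightarrow> (\<forall>y\<in>A. (x, y) \<notin> E)"

lemma ind_empty [simp]: "ind {} = 1"
  by (simp add: ind_def)

lemma ind_nonneg [simp]: "0 \<le> ind A"
  by (simp add: ind_def)

text \<open>
  Up to sign, \<open>slog ind v V\<close> counts the acyclic orientations of the graph induced on \<open>V\<close> whose only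
  sink is \<open>v\<close>. This motivates the sums below, but the orientations themselves are never needed.
\<close>

definition sinks :: "'v \<Rightarrow> 'v set \<Rightarrow> int" where
  "sinks v V = (- 1) ^ (card V + 1) * slog ind v V"

lemma isolated_subset: "isolated x A \<Longrightarrow> B \<subseteq> A \<Longrightarrow> isolated x B"
  by (auto simp: isolated_def)

lemma ind_edge: "x \<in> V \<Longrightarrow> \<not> isolated x V \<Longrightarrow> ind V = 0"
  by (auto simp: ind_def isolated_def)

section \<open>Non-negativity of signed sums of unique-sink counts\<close>

context
  assumes sym_E: "sym E" and irrefl_E: "irrefl E"
begin

lemma ind_singleton [simp]: "ind {v} = 1"
  using irrefl_E by (simp add: ind_def irrefl_def)

lemma ind_insert_isolated: "isolated x A \<Longrightarrow> ind (insert x A) = ind A"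
  using sym_E irrefl_E by (auto simp: ind_def isolated_def irrefl_def sym_def)

lemma ind_Un: "ind (J \<union> K) = ind J * ind K * of_bool (\<forall>x\<in>J. isolated x K)"
proof -
  have "(\<forall>u\<in>J \<union> K. \<forall>w\<in>J \<union> K. (u, w) \<notin> E) \<longleftrightarrow>
      (\<forall>u\<in>J. \<forall>w\<in>J. (u, w) \<notin> E) \<and> (\<forall>u\<in>K. \<forall>w\<in>K. (u, w) \<notin> E) \<and> (\<forall>x\<in>J. isolated x K)"
    using sym_E unfolding isolated_def sym_def by blast
  then show ?thesis
    by (simp add: ind_def flip: of_bool_conj)
qed

text \<open>An isolated vertex besides \<open>v\<close> is a second sink. Algebraically, the
  recursion collapses to the one for V without x, whose value is already
  \<open>ind V\<close>.\<close>

lemma slog_isolated: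
  assumes "finite V" "x \<in> V" "v \<in> V" "x \<noteq> v" "isolated x V"
  shows "slog ind v V = 0"
  using assms
proof (induction V rule: finite_psubset_induct)
  case (psubset V)
  let ?V = "V - {x}"
  have V: "V = insert x ?V"
    using psubset.prems by auto
  have "(\<Sum>W | v \<in> W \<and> W \<subset> V. slog ind v W * ind (V - W)) =
      (\<Sum>W | v \<in> W \<and> W \<subseteq> ?V. slog ind v W * ind (V - W))"
  proof (rule sum.mono_neutral_right)
    show "finite {W. v \<in> W \<and> W \<subset> V}"
      using psubset.hyps by (auto intro: finite_subset[of _ "Pow V"])
    show "{W. v \<in> W \<and> W \<subseteq> ?V} \<subseteq> {W. v \<in> W \<and> W \<subset> V}"
      using psubset.prems by auto
    show "\<forall>W\<in>{W. v \<in> W \<and> W \<subset> V} - {W. v \<in> W \<and> W \<subseteq> ?V}. slog ind v W * ind (V - W) = 0"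
    proof
      fix W assume W: "W \<in> {W. v \<in> W \<and> W \<subset> V} - {W. v \<in> W \<and> W \<subseteq> ?V}"
      then have "x \<in> W" "W \<subset> V" "v \<in> W"
        by auto
      moreover have "isolated x W"
        using \<open>W \<subset> V\<close> psubset.prems(4) isolated_subset by blast
      ultimately show "slog ind v W * ind (V - W) = 0"
        using psubset.IH[of W] psubset.prems by simp
    qed
  qed
  also have "\<dots> = (\<Sum>W | v \<in> W \<and> W \<subseteq> ?V. slog ind v W * ind (?V - W))"
  proof (intro sum.cong refl)
    fix W assume W: "W \<in> {W. v \<in> W \<and> W \<subseteq> ?V}"
    then have "V - W = insert x (?V - W)"
      using psubset.prems by auto
    moreover have "isolated x (?V - W)"
      by (rule isolated_subset[OF psubset.prems(4)]) auto
    ultimately show "slog ind v W * ind (V - W) = slog ind v W * ind (?V - W)"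
      using ind_insert_isolated by simp
  qed
  also have "\<dots> = ind ?V"
    using psubset by (intro slog_rec[symmetric]) auto
  also have "\<dots> = ind V"
    using ind_insert_isolated[of x ?V] isolated_subset[OF psubset.prems(4), of ?V] V by auto
  finally show ?case
    using psubset.hyps by (simp add: slog.simps[of ind v V])
qed

lemma sinks_isolated:
  "finite V \<Longrightarrow> x \<in> V \<Longrightarrow> v \<in> V \<Longrightarrow> x \<noteq> v \<Longrightarrow> isolated x V \<Longrightarrow> sinks v V = 0"
  by (simp add: sinks_def slog_isolated)

text \<open>This is \<open>slog_rec\<close> with K = V - W. It evaluates the term J = {} of the
  Moebius sums below, which therefore vanishes once V has an edge.\<close>

lemma sinks_total:
  assumes "finite V" "v \<in> V"
  shows "(\<Sum>K\<in>Pow (V - {v}). (- 1) ^ card K * (ind K * sinks v (V - K))) = (- 1) ^ (card V + 1) * ind V"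
proof -
  have "(- 1) ^ card K * (ind K * sinks v (V - K)) =
      (- 1) ^ (card V + 1) * (slog ind v (V - K) * ind (V - (V - K)))"
    if "K \<in> Pow (V - {v})" for K
  proof -
    have "K \<subseteq> V"
      using that by auto
    then have "card (V - K) + card K = card V" and eq: "V - (V - K) = K"
      using assms card_mono[of V K] finite_subset[of K V] by (auto simp: card_Diff_subset)
    then have "(- 1) ^ card V = (- 1 :: int) ^ card K * (- 1) ^ card (V - K)"
      by (metis add.commute power_add)
    then show ?thesis
      by (simp add: sinks_def eq mult_ac)
  qed
  then have "(\<Sum>K\<in>Pow (V - {v}). (- 1) ^ card K * (ind K * sinks v (V - K))) =
      (- 1) ^ (card V + 1) * (\<Sum>K\<in>Pow (V - {v}). slog ind v (V - K) * ind (V - (V - K)))"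
    by (simp add: sum_distrib_left)
  also have "(\<Sum>K\<in>Pow (V - {v}). slog ind v (V - K) * ind (V - (V - K))) =
      (\<Sum>W | v \<in> W \<and> W \<subseteq> V. slog ind v W * ind (V - W))"
    using assms by (intro sum.reindex_bij_witness[where i = "\<lambda>W. V - W" and j = "\<lambda>W. V - W"]) auto
  also have "\<dots> = ind V"
    using assms by (intro slog_rec[symmetric]) auto
  finally show ?thesis .
qed

text \<open>Only non-neighbours of J can join J in an independent set. In terms of orientations,
  without isolated vertices: J is the full source set iff every source other than v that appears
  after deleting J is adjacent to J.\<close>

lemma moebius_sinks:
  assumes "finite V" "J \<subseteq> V - {v}"
  shows "(\<Sum>K\<in>Pow (V - {v} - J). (- 1) ^ card K * (ind (J \<union> K) * sinks v (V - (J \<union> K)))) =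
    ind J * (\<Sum>K\<in>Pow {y \<in> V - J - {v}. \<forall>x\<in>J. (x, y) \<notin> E}. (- 1) ^ card K * (ind K * sinks v (V - J - K)))"
proof -
  have "(\<Sum>K\<in>Pow (V - {v} - J). (- 1) ^ card K * (ind (J \<union> K) * sinks v (V - (J \<union> K)))) =
      (\<Sum>K\<in>Pow {y \<in> V - J - {v}. \<forall>x\<in>J. (x, y) \<notin> E}. (- 1) ^ card K * (ind (J \<union> K) * sinks v (V - (J \<union> K))))"
    using assms by (intro sum.mono_neutral_right) (auto simp: ind_Un isolated_def)
  also have "\<dots> = (\<Sum>K\<in>Pow {y \<in> V - J - {v}. \<forall>x\<in>J. (x, y) \<notin> E}.
      ind J * ((- 1) ^ card K * (ind K * sinks v (V - J - K))))"
    by (intro sum.cong) (auto simp: ind_Un isolated_def set_diff_eq intro!: arg_cong[of _ _ "sinks v"])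
  finally show ?thesis
    by (simp add: sum_distrib_left)
qed

text \<open>
  The sum counts the orientations with unique sink \<open>v\<close> none of whose sources lie in \<open>U\<close>. The
  induction removes the set \<open>J\<close> of all sources.
\<close>

lemma sinks_avoiding_nonneg:
  assumes "finite V" "v \<in> V" "U \<subseteq> V - {v}" "\<And>x. x \<in> U \<Longrightarrow> \<not> isolated x V"
  shows "0 \<le> (\<Sum>K\<in>Pow U. (- 1) ^ card K * (ind K * sinks v (V - K)))"
  using assms
proof (induction V arbitrary: U rule: finite_psubset_induct)
  case (psubset V)
  show ?case
  proof (cases "\<exists>x\<in>V - {v}. isolated x V")
    case True
    then obtain x where x: "x \<in> V" "x \<noteq> v" "isolated x V"
      by auto
    \<comment> \<open>Being isolated, x lies outside U and so survives in V - K as a second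
      sink.\<close>
    have "sinks v (V - K) = 0" if "K \<in> Pow U" for K
      using that psubset.prems psubset.hyps x
      by (intro sinks_isolated[of _ x]) (auto intro: isolated_subset)
    then show ?thesis
      by simp
  next
    case no_iso: False
    show ?thesis
    proof (cases "V = {v}")
      case True
      then have "U = {}"
        using psubset.prems by auto
      moreover have "slog ind v {v} = 1"
      proof -
        have "{W. v \<in> W \<and> W \<subset> {v}} = {}"
          by auto
        then show ?thesis
          by (simp only: slog.simps[of ind v "{v}"] sum.empty) simp
      qed
      ultimately show ?thesis
        using True by (simp add: sinks_def)
    next
      case False
      let ?T = "V - {v}"
      let ?g = "\<lambda>I. ind I * sinks v (V - I)"
      let ?b = "\<lambda>J. \<Sum>K\<in>Pow (?T - J). (- 1) ^ card K * ?g (J \<union> K)"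
      \<comment> \<open>The weight is cut off outside U, so its sum over the subsets of J is the
        indicator that J misses U, which selects the source sets to be counted.\<close>
      have "(\<Sum>K\<in>Pow U. (- 1) ^ card K * ?g K) =
          (\<Sum>K\<in>Pow ?T. (if K \<subseteq> U then (- 1) ^ card K else 0) * ?g K)"
        using psubset.prems psubset.hyps by (intro sum.mono_neutral_cong_left) auto
      also have "\<dots> = (\<Sum>J\<in>Pow ?T. (\<Sum>I\<in>Pow J. if I \<subseteq> U then (- 1) ^ card I else 0) * ?b J)"
        using psubset.hyps by (intro sum_Pow_moebius) auto
      also have "\<dots> \<ge> 0"
      proof (rule sum_nonneg, rule mult_nonneg_nonneg)
        fix J assume J: "J \<in> Pow ?T"
        have "(\<Sum>I\<in>Pow J. if I \<subseteq> U then (- 1) ^ card I else 0) = (\<Sum>I\<in>Pow (J \<inter> U). (- 1 :: int) ^ card I)"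
          using J psubset.hyps by (intro sum.mono_neutral_cong_right) (auto intro: finite_subset)
        also have "\<dots> = of_bool (J \<inter> U = {})"
          using J psubset.hyps by (intro sum_Pow_alternating) (auto intro: finite_subset)
        finally show "0 \<le> (\<Sum>I\<in>Pow J. if I \<subseteq> U then (- 1) ^ card I else 0 :: int)"
          by (simp only:) simp
        show "0 \<le> ?b J"
        proof (cases "J = {}")
          case True
          from False obtain x where x: "x \<in> V" "x \<noteq> v"
            using psubset.prems by auto
          then have "ind V = 0"
            using no_iso ind_edge by blast
          then show ?thesis
            using True sinks_total[of V v] psubset.hyps psubset.prems by simp
        next
          case False
          have "0 \<le> (\<Sum>K\<in>Pow {y \<in> V - J - {v}. \<forall>x\<in>J. (x, y) \<notin> E}. (- 1) ^ card K * (ind K * sinks v (V - J - K)))"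
          proof (rule psubset.IH)
            show "V - J \<subset> V" "v \<in> V - J" "{y \<in> V - J - {v}. \<forall>x\<in>J. (x, y) \<notin> E} \<subseteq> V - J - {v}"
              using J False psubset.prems by auto
            \<comment> \<open>The vertex y has a neighbour in V, and that neighbour cannot be in
              J.\<close>
            show "\<not> isolated y (V - J)" if "y \<in> {y \<in> V - J - {v}. \<forall>x\<in>J. (x, y) \<notin> E}" for y
              using that no_iso sym_E by (auto simp: isolated_def sym_def) blast
          qed
          then show ?thesis
            using J psubset.hyps by (subst moebius_sinks) auto
        qed
      qed
      finally show ?thesis .
    qed
  qed
qed

text \<open>Without isolated vertices the sum is regrouped by source sets J; the size bound provides
  a vertex besides v, whose edge kills the term J = {}. An isolated vertex must lie in I, since
  otherwise it is a second sink; deleting it lowers m and the size of V together.\<close>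

lemma truncated_sinks_nonneg:
  assumes "finite V" "v \<in> V" "m + 2 \<le> card V"
  shows "0 \<le> (\<Sum>I\<in>Pow (V - {v}). (if card I \<le> m then (- 1) ^ (m - card I) else 0) * (ind I * sinks v (V - I)))"
  using assms
proof (induction V arbitrary: m rule: finite_psubset_induct)
  case (psubset V)
  let ?T = "V - {v}"
  let ?g = "\<lambda>I. ind I * sinks v (V - I)"
  let ?t = "\<lambda>m i. if i \<le> m then (- 1) ^ (m - i) else 0 :: int"
  show ?case
  proof (cases "\<exists>x\<in>V - {v}. isolated x V")
    case True
    then obtain x where x: "x \<in> V" "x \<noteq> v" "isolated x V"
      by auto
    let ?V = "V - {x}"
    have T: "?T = insert x (?V - {v})"
      using x by auto
    have "(\<Sum>I\<in>Pow (?V - {v}). ?t m (card I) * ?g I) = 0"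
    proof (rule sum.neutral, rule ballI)
      fix I assume "I \<in> Pow (?V - {v})"
      then have "sinks v (V - I) = 0"
        using psubset.prems psubset.hyps x
        by (intro sinks_isolated[of _ x]) (auto intro: isolated_subset)
      then show "?t m (card I) * ?g I = 0"
        by simp
    qed
    then have "(\<Sum>I\<in>Pow ?T. ?t m (card I) * ?g I) =
        (\<Sum>I\<in>Pow (?V - {v}). ?t m (card (insert x I)) * ?g (insert x I))"
      unfolding T using psubset.hyps x by (subst sum_Pow_insert) auto
    also have "\<dots> = (\<Sum>I\<in>Pow (?V - {v}). ?t m (Suc (card I)) * (ind I * sinks v (?V - I)))"
    proof (rule sum.cong[OF refl])
      fix I assume I: "I \<in> Pow (?V - {v})"
      then have "finite I" "x \<notin> I" "V - insert x I = ?V - I"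
        using psubset.hyps by (auto intro: finite_subset)
      moreover have "isolated x I"
        using I by (intro isolated_subset[OF x(3)]) auto
      ultimately show "?t m (card (insert x I)) * ?g (insert x I) =
          ?t m (Suc (card I)) * (ind I * sinks v (?V - I))"
        by (simp add: ind_insert_isolated)
    qed
    also have "\<dots> \<ge> 0"
    \<comment> \<open>For m = 0 any I containing x is already too large, so every weight is
      0.\<close>
    proof (cases m)
      case (Suc m')
      have "card ?V = card V - 1"
        using x psubset.hyps by simp
      then have "0 \<le> (\<Sum>I\<in>Pow (?V - {v}). ?t m' (card I) * (ind I * sinks v (?V - I)))"
        using x psubset.prems Suc by (intro psubset.IH) auto
      then show ?thesis
        by (simp add: Suc cong: if_cong)
    qed simp
    finally show ?thesis .
  next
    case no_iso: False
    let ?b = "\<lambda>J. \<Sum>K\<in>Pow (?T - J). (- 1) ^ card K * ?g (J \<union> K)"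
    have "(\<Sum>I\<in>Pow ?T. ?t m (card I) * ?g I) = (\<Sum>J\<in>Pow ?T. (\<Sum>I\<in>Pow J. ?t m (card I)) * ?b J)"
      using psubset.hyps by (intro sum_Pow_moebius) auto
    also have "\<dots> \<ge> 0"
    proof (rule sum_nonneg)
      fix J assume J: "J \<in> Pow ?T"
      show "0 \<le> (\<Sum>I\<in>Pow J. ?t m (card I)) * ?b J"
      proof (cases "J = {}")
        case True
        have "card ?T > 0"
          using psubset.prems psubset.hyps by simp
        then obtain x where "x \<in> ?T"
          by (metis card.empty ex_in_conv less_irrefl)
        then have "ind V = 0"
          using no_iso ind_edge by blast
        then show ?thesis
          using True sinks_total[of V v] psubset.hyps psubset.prems by simp
      next
        case False
        have "0 \<le> (\<Sum>K\<in>Pow {y \<in> V - J - {v}. \<forall>x\<in>J. (x, y) \<notin> E}. (- 1) ^ card K * (ind K * sinks v (V - J - K)))"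
        proof (rule sinks_avoiding_nonneg)
          show "finite (V - J)" "v \<in> V - J" "{y \<in> V - J - {v}. \<forall>x\<in>J. (x, y) \<notin> E} \<subseteq> V - J - {v}"
            using J psubset by auto
          show "\<not> isolated y (V - J)" if "y \<in> {y \<in> V - J - {v}. \<forall>x\<in>J. (x, y) \<notin> E}" for y
            using that no_iso sym_E by (auto simp: isolated_def sym_def) blast
        qed
        then have "0 \<le> ?b J"
          using J psubset.hyps by (subst moebius_sinks) auto
        moreover have "0 \<le> (\<Sum>I\<in>Pow J. ?t m (card I))"
          using J False psubset.hyps by (intro sum_Pow_alternating_truncated) (auto intro: finite_subset)
        ultimately show ?thesis
          by simp
      qed
    qed
    finally show ?thesis .
  qed
qed

text \<open>Put I = V - W and m = card V - k. Then m - card I = card W - k, so the sign in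
  \<open>sinks\<close> and the truncated weight combine to (-1)^(k+1), and \<open>2 \<le> k\<close>
  becomes \<open>m + 2 \<le> card V\<close>.\<close>

lemma slog_tail_nonneg:
  assumes "finite V" "v \<in> V" "2 \<le> k" "k \<le> card V"
  shows "0 \<le> (\<Sum>W | v \<in> W \<and> W \<subseteq> V. slog ind v W * ((- 1) ^ (k + 1) * of_bool (k \<le> card W)) * ind (V - W))"
proof -
  let ?m = "card V - k"
  have "(\<Sum>W | v \<in> W \<and> W \<subseteq> V. slog ind v W * ((- 1) ^ (k + 1) * of_bool (k \<le> card W)) * ind (V - W)) =
    (\<Sum>I\<in>Pow (V - {v}). (if card I \<le> ?m then (- 1) ^ (?m - card I) else 0) * (ind I * sinks v (V - I)))"
  proof (rule sum.reindex_bij_witness[where i = "\<lambda>I. V - I" and j = "\<lambda>W. V - W"])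
    fix W assume W: "W \<in> {W. v \<in> W \<and> W \<subseteq> V}"
    have card: "card (V - W) + card W = card V" and eq: "V - (V - W) = W"
      using W assms card_mono[of V W] by (auto simp: card_Diff_subset finite_subset)
    have iff: "card (V - W) \<le> ?m \<longleftrightarrow> k \<le> card W"
      using card assms(4) by linarith
    have "(- 1) ^ (?m - card (V - W)) * (- 1) ^ (card W + 1) = (- 1 :: int) ^ (k + 1)"
      if "k \<le> card W"
    proof -
      have "?m - card (V - W) + (card W + 1) = (k + 1) + 2 * (card W - k)"
        using that card assms(4) by linarith
      then show ?thesis
        by (metis minus_one_power_iff even_add even_mult_iff even_numeral power_add)
    qed
    then show "(if card (V - W) \<le> ?m then (- 1) ^ (?m - card (V - W)) else 0) *
        (ind (V - W) * sinks v (V - (V - W))) =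
        slog ind v W * ((- 1) ^ (k + 1) * of_bool (k \<le> card W)) * ind (V - W)"
      unfolding iff eq sinks_def by (simp add: mult_ac)
  qed (use assms in auto)
  also have "\<dots> \<ge> 0"
    using assms by (intro truncated_sinks_nonneg) auto
  finally show ?thesis .
qed

end

end


section \<open>Series of monomials\<close>

lemma mfps_nth_simps [simp]:
  "mfps_nth 0 m = 0" "mfps_nth (f + g) m = mfps_nth f m + mfps_nth g m"
  "mfps_nth (f - g) m = mfps_nth f m - mfps_nth g m" "mfps_nth (- f) m = - mfps_nth f m"
  by (transfer; simp)+

lemma mfps_nth_one: "mfps_nth 1 m = (if m = 0 then 1 else 0)"
  by transfer simp

lemma mfps_nth_times:
  "mfps_nth (f * g) m = (\<Sum>(a, b) | a + b = m. mfps_nth f a * mfps_nth g b)"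
  by (simp add: times_mfps.rep_eq)

lemma mfps_nth_sum: "mfps_nth (\<Sum>x\<in>A. F x) m = (\<Sum>x\<in>A. mfps_nth (F x) m)"
  by (induction A rule: infinite_finite_induct) auto

lemma mfps_nth_of_nat_times: "mfps_nth (of_nat n * f) m = of_nat n * mfps_nth f m"
  by (induction n) (auto simp: algebra_simps)

lemma mfps_nth_of_int_times: "mfps_nth (of_int c * f) m = c * mfps_nth (f :: int mfps) m"
  by (cases c rule: int_cases2) (simp_all add: mfps_nth_of_nat_times)

lemma monomial_series_bij_betw:
  assumes "bij_betw g A B" "\<And>x. x \<in> A \<Longrightarrow> w' (g x) = w x"
  shows "monomial_series A w = monomial_series B w'"
proof (rule mfps_eqI)
  fix m
  have "bij_betw g {a \<in> A. w a = m} {b \<in> B. w' b = m}"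
    using assms unfolding bij_betw_def by (auto intro: inj_on_subset)
  then show "mfps_nth (monomial_series A w) m = mfps_nth (monomial_series B w') m"
    by (simp add: mfps_nth_monomial_series bij_betw_same_card)
qed

lemma monomial_series_Un_disjoint:
  assumes "\<And>m. finite {a \<in> A \<union> B. w a = m}" "A \<inter> B = {}"
  shows "monomial_series (A \<union> B) w = monomial_series A w + monomial_series B w"
proof (rule mfps_eqI)
  fix m
  have "{a \<in> A \<union> B. w a = m} = {a \<in> A. w a = m} \<union> {a \<in> B. w a = m}"
    by auto
  moreover have "card ({a \<in> A. w a = m} \<union> {a \<in> B. w a = m}) = card {a \<in> A. w a = m} + card {a \<in> B. w a = m}"
    using assms(2) by (intro card_Un_disjoint) (auto intro: finite_subset[OF _ assms(1)[of m]])
  ultimately show "mfps_nth (monomial_series (A \<union> B) w) m =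
      mfps_nth (monomial_series A w + monomial_series B w) m"
    by (simp add: mfps_nth_monomial_series)
qed

lemma monomial_product_fibre:
  "{x \<in> A \<times> B. (case x of (a, b) \<Rightarrow> w a + w' b) = m} =
    (\<Union>(s, t)\<in>{(s, t). s + t = m}. {a \<in> A. w a = s} \<times> {b \<in> B. w' b = t})"
  by auto

lemma finite_monomial_product_fibre:
  fixes w :: "'a \<Rightarrow> (nat \<Rightarrow>\<^sub>0 nat)" and w' :: "'b \<Rightarrow> (nat \<Rightarrow>\<^sub>0 nat)"
  assumes "\<And>m. finite {a \<in> A. w a = m}" "\<And>m. finite {b \<in> B. w' b = m}"
  shows "finite {x \<in> A \<times> B. (case x of (a, b) \<Rightarrow> w a + w' b) = m}"
  unfolding monomial_product_fibre using assms finite_monomial_splits[of m] by auto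

lemma monomial_series_times:
  assumes "\<And>m. finite {a \<in> A. w a = m}" "\<And>m. finite {b \<in> B. w' b = m}"
  shows "monomial_series A w * monomial_series B w' = monomial_series (A \<times> B) (\<lambda>(a, b). w a + w' b)"
proof (rule mfps_eqI)
  fix m
  have "card {x \<in> A \<times> B. (case x of (a, b) \<Rightarrow> w a + w' b) = m} =
      (\<Sum>x | fst x + snd x = m. card ({a \<in> A. w a = fst x} \<times> {b \<in> B. w' b = snd x}))"
    unfolding monomial_product_fibre
    using assms finite_monomial_splits[of m]
    by (subst card_UN_disjoint) (auto simp: case_prod_unfold)
  then show "mfps_nth (monomial_series A w * monomial_series B w') m =
      mfps_nth (monomial_series (A \<times> B) (\<lambda>(a, b). w a + w' b)) m"
    by (simp add: mfps_nth_monomial_series mfps_nth_times case_prod_unfold card_cartesian_product)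
qed


section \<open>Newton's identities\<close>

definition power_sum :: "nat \<Rightarrow> int mfps" where
  "power_sum j = monomial_series UNIV (\<lambda>i. Poly_Mapping.single i j)"

lemma finite_power_sum_fibre:
  "(j :: nat) > 0 \<Longrightarrow> finite {i \<in> UNIV. Poly_Mapping.single (i :: nat) j = m}"
proof (cases "\<exists>i. Poly_Mapping.single i j = m")
  case True
  assume "j > 0"
  from True obtain i where i: "Poly_Mapping.single i j = m"
    by auto
  have "{i' \<in> UNIV. Poly_Mapping.single i' j = m} \<subseteq> {i}"
  proof
    fix i' assume "i' \<in> {i' \<in> UNIV. Poly_Mapping.single i' j = m}"
    then have "Poly_Mapping.keys (Poly_Mapping.single i' j) = Poly_Mapping.keys (Poly_Mapping.single i j)"
      using i by simp
    then show "i' \<in> {i}"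
      using \<open>j > 0\<close> by simp
  qed
  then show ?thesis
    by (rule finite_subset) simp
qed auto

abbreviation set_monomial :: "nat set \<Rightarrow> (nat \<Rightarrow>\<^sub>0 nat)" where
  "set_monomial S \<equiv> \<Sum>i\<in>S. Poly_Mapping.single i 1"

text \<open>The monomial symmetric function of the partition \<open>(i, 1, \<dots>, 1)\<close> of \<open>r + i\<close>, for \<open>i > 1\<close>.\<close>

definition hook_monomial :: "nat \<Rightarrow> nat \<Rightarrow> int mfps" where
  "hook_monomial r i = monomial_series {(S, j). finite S \<and> card S = r \<and> j \<notin> S}
     (\<lambda>(S, j). set_monomial S + Poly_Mapping.single j i)"

lemma hook_monomial_0: "hook_monomial 0 i = power_sum i"
  unfolding hook_monomial_def power_sum_def
  by (rule monomial_series_bij_betw[where g = snd])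
    (auto simp: bij_betw_def inj_on_def image_iff intro!: exI[of _ "{}"])

text \<open>With exponent 1 the marked index is indistinguishable from the others, so each set of
  size r + 1 arises once for every choice of mark.\<close>

lemma hook_monomial_1: "hook_monomial r 1 = of_nat (Suc r) * esym (Suc r)"
proof (rule mfps_eqI)
  fix m
  let ?T = "{T \<in> {S. finite S \<and> card S = Suc r}. set_monomial T = m}"
  let ?A = "{x \<in> {(S, j). finite S \<and> card S = r \<and> j \<notin> S}.
    (case x of (S, j) \<Rightarrow> set_monomial S + Poly_Mapping.single j 1) = m}"
  have "bij_betw (\<lambda>(S, j). (insert j S, j)) ?A (SIGMA T:?T. T)"
    by (rule bij_betw_byWitness[where f' = "\<lambda>(T, j). (T - {j}, j)"])
      (auto simp: add.commute insert_absorb sum.remove)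
  then have "card ?A = card (SIGMA T:?T. T)"
    by (rule bij_betw_same_card)
  also have "\<dots> = (\<Sum>T\<in>?T. card T)"
    using finite_sets_with_monomial[of "Suc r" m] by (intro card_SigmaI) auto
  also have "\<dots> = Suc r * card ?T"
    by simp
  finally have "int (card ?A) = of_nat (Suc r) * int (card ?T)"
    by (simp only: of_nat_mult)
  then show "mfps_nth (hook_monomial r 1) m = mfps_nth (of_nat (Suc r) * esym (Suc r)) m"
    unfolding hook_monomial_def esym_def mfps_nth_of_nat_times mfps_nth_monomial_series .
qed

text \<open>The index of the power sum either avoids S or raises the exponent of one of its
  elements.\<close>

lemma esym_times_power_sum:
  assumes "i > 0"
  shows "esym (Suc r) * power_sum i = hook_monomial (Suc r) i + hook_monomial r (Suc i)"
proof -
  let ?w = "\<lambda>(S, j). set_monomial S + Poly_Mapping.single j i"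
  let ?A = "{(S, j). finite S \<and> card S = Suc r \<and> j \<notin> S}"
  let ?B = "{(S, j). finite S \<and> card S = Suc r \<and> j \<in> S}"
  have fin: "finite {x \<in> {S. finite S \<and> card S = Suc r} \<times> UNIV. ?w x = m}" for m
    by (intro finite_monomial_product_fibre finite_power_sum_fibre[OF assms] finite_sets_with_monomial)
  have eq: "{S. finite S \<and> card S = Suc r} \<times> UNIV = ?A \<union> ?B"
    by auto
  have "esym (Suc r) * power_sum i = monomial_series ({S. finite S \<and> card S = Suc r} \<times> UNIV) ?w"
    unfolding esym_def power_sum_def
    by (intro monomial_series_times finite_power_sum_fibre[OF assms] finite_sets_with_monomial)
  also have "\<dots> = monomial_series ?A ?w + monomial_series ?B ?w"
    using fin unfolding eq by (intro monomial_series_Un_disjoint) auto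
  also have "monomial_series ?B ?w = hook_monomial r (Suc i)"
    unfolding hook_monomial_def
  proof (rule monomial_series_bij_betw[where g = "\<lambda>(S, j). (S - {j}, j)"])
    show "bij_betw (\<lambda>(S, j). (S - {j}, j)) ?B {(S, j). finite S \<and> card S = r \<and> j \<notin> S}"
      by (rule bij_betw_byWitness[where f' = "\<lambda>(S, j). (insert j S, j)"]) auto
    show "(case (\<lambda>(S, j). (S - {j}, j)) x of (S, j) \<Rightarrow> set_monomial S + Poly_Mapping.single j (Suc i)) = ?w x"
      if "x \<in> ?B" for x
    proof -
      obtain S j where x: "x = (S, j)" "finite S" "j \<in> S"
        using \<open>x \<in> ?B\<close> by auto
      have "Poly_Mapping.single j (Suc i) = Poly_Mapping.single j 1 + Poly_Mapping.single j i"
        by (simp flip: single_add)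
      then show ?thesis
        using x by (simp add: sum.remove[of S j] add_ac)
    qed
  qed
  finally show ?thesis
    by (simp add: hook_monomial_def)
qed


section \<open>Polynomials in the elementary symmetric functions\<close>

text \<open>
  An abstract polynomial ring: the multiset \<open>M\<close> is the monomial that is the product of the
  generators indexed by its elements.
\<close>

type_synonym epoly = "nat multiset \<Rightarrow>\<^sub>0 int"

definition egen :: "nat \<Rightarrow> epoly" where
  "egen k = Poly_Mapping.single {#k#} 1"

text \<open>The target ring is general because the same polynomial is evaluated at
  \<open>esym\<close> and at specialisations in \<open>int poly\<close>.\<close>

definition epoly_eval :: "(nat \<Rightarrow> 'r :: comm_ring_1) \<Rightarrow> epoly \<Rightarrow> 'r" where
  "epoly_eval f F = (\<Sum>M\<in>Poly_Mapping.keys F. of_int (Poly_Mapping.lookup F M) * prod_mset (image_mset f M))"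

lemma epoly_eval_superset:
  assumes "finite S" "Poly_Mapping.keys F \<subseteq> S"
  shows "epoly_eval f F = (\<Sum>M\<in>S. of_int (Poly_Mapping.lookup F M) * prod_mset (image_mset f M))"
  unfolding epoly_eval_def using assms by (intro sum.mono_neutral_left) (auto simp: in_keys_iff)

lemma epoly_eval_single:
  "epoly_eval f (Poly_Mapping.single M c) = of_int c * prod_mset (image_mset f M)"
  by (subst epoly_eval_superset[of "{M}"]) auto

lemma epoly_eval_egen [simp]: "epoly_eval f (egen k) = f k"
  by (simp add: egen_def epoly_eval_single)

lemma epoly_eval_0 [simp]: "epoly_eval f 0 = 0"
  by (simp add: epoly_eval_def)

lemma epoly_eval_1 [simp]: "epoly_eval f 1 = 1"
  using epoly_eval_single[of f 0 1] by simp

lemma epoly_eval_diff [simp]: "epoly_eval f (F - G) = epoly_eval f F - epoly_eval f G"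
proof -
  let ?S = "Poly_Mapping.keys F \<union> Poly_Mapping.keys G"
  have "Poly_Mapping.keys (F - G) \<subseteq> ?S"
    by (rule keys_diff)
  then show ?thesis
    by (simp add: epoly_eval_superset[of ?S] lookup_minus left_diff_distrib sum_subtractf)
qed

lemma epoly_eval_uminus [simp]: "epoly_eval f (- F) = - epoly_eval f F"
  using epoly_eval_diff[of f 0 F] by simp

lemma epoly_eval_add [simp]: "epoly_eval f (F + G) = epoly_eval f F + epoly_eval f G"
  using epoly_eval_diff[of f F "- G"] by simp

lemma epoly_eval_sum: "epoly_eval f (\<Sum>x\<in>A. F x) = (\<Sum>x\<in>A. epoly_eval f (F x))"
  by (induction A rule: infinite_finite_induct) auto

lemma epoly_eval_of_nat [simp]: "epoly_eval f (of_nat n) = of_nat n"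
  by (induction n) auto

lemma epoly_eval_of_int [simp]: "epoly_eval f (of_int c) = of_int c"
  by (cases c rule: int_cases2) auto

lemma epoly_eval_times [simp]: "epoly_eval f (F * G) = epoly_eval f F * epoly_eval f G"
proof -
  have "Poly_Mapping.keys F \<subseteq> UNIV"
    by simp
  then show ?thesis
  \<comment> \<open>With integer coefficients \<open>epoly\<close> is the free abelian group on the
    monomials, so single monomials and differences suffice.\<close>
  proof (induction F rule: frag_induction)
    case (one M)
    have "Poly_Mapping.keys G \<subseteq> UNIV"
      by simp
    then show ?case
    proof (induction G rule: frag_induction)
      case (one N)
      then show ?case
        by (simp add: mult_single epoly_eval_single)
    qed (simp_all add: right_diff_distrib)
  qed (simp_all add: left_diff_distrib)
qed

lemma epoly_eval_power [simp]: "epoly_eval f (F ^ n) = epoly_eval f F ^ n"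
  by (induction n) auto

text \<open>Here e_i has degree i. Index 0 is excluded since \<open>esym 0\<close> is 1, which would
  destroy uniqueness.\<close>

definition homog :: "nat \<Rightarrow> epoly \<Rightarrow> bool" where
  "homog n F \<longleftrightarrow> (\<forall>M\<in>Poly_Mapping.keys F. sum_mset M = n \<and> 0 \<notin># M)"

lemma homog_0 [simp]: "homog n 0"
  by (simp add: homog_def)

lemma homog_1 [simp]: "homog 0 1"
  by (simp add: homog_def)

lemma homog_egen: "k > 0 \<Longrightarrow> homog k (egen k)"
  by (simp add: homog_def egen_def)

lemma homog_diff: "homog n F \<Longrightarrow> homog n G \<Longrightarrow> homog n (F - G)"
  using keys_diff[of F G] unfolding homog_def by blast

lemma homog_add: "homog n F \<Longrightarrow> homog n G \<Longrightarrow> homog n (F + G)"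
  using keys_add[of F G] unfolding homog_def by blast

lemma homog_times: "homog m F \<Longrightarrow> homog n G \<Longrightarrow> homog (m + n) (F * G)"
  using keys_mult[of F G] unfolding homog_def by fastforce

lemma homog_sum: "(\<And>x. x \<in> A \<Longrightarrow> homog n (F x)) \<Longrightarrow> homog n (\<Sum>x\<in>A. F x)"
  by (induction A rule: infinite_finite_induct) (auto intro: homog_add)

lemma homog_of_nat: "homog 0 (of_nat n)"
  by (induction n) (auto intro: homog_add)

lemma homog_of_int: "homog 0 (of_int c)"
  using homog_diff[OF homog_0 homog_of_nat] homog_of_nat by (cases c rule: int_cases2) auto

text \<open>The last equation is \<open>esym_times_power_sum\<close> solved for the hook with the
  larger exponent; \<open>ehook 0 (Suc i)\<close> stands for the power sum p_(i+1). The value at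
  exponent 0 is a default.\<close>

fun ehook :: "nat \<Rightarrow> nat \<Rightarrow> epoly" where
  "ehook r 0 = 0"
| "ehook r (Suc 0) = of_nat (Suc r) * egen (Suc r)"
| "ehook r (Suc (Suc i)) = egen (Suc r) * ehook 0 (Suc i) - ehook (Suc r) (Suc i)"

lemma epoly_eval_ehook: "epoly_eval esym (ehook r (Suc i)) = hook_monomial r (Suc i)"
proof (induction i arbitrary: r)
  case 0
  then show ?case
    using hook_monomial_1[of r] by simp
next
  case (Suc i)
  then show ?case
    using esym_times_power_sum[of "Suc i" r] by (simp add: hook_monomial_0)
qed

lemma homog_ehook: "homog (r + Suc i) (ehook r (Suc i))"
proof (induction i arbitrary: r)
  case 0
  then show ?case
    using homog_times[OF homog_of_nat homog_egen, of "Suc r" "Suc r"] by simp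
next
  case (Suc i)
  have "homog (Suc r + (0 + Suc i)) (egen (Suc r) * ehook 0 (Suc i))"
    by (intro homog_times homog_egen Suc.IH) simp
  then show ?case
    using Suc.IH[of "Suc r"] by (auto intro: homog_diff)
qed

text \<open>Unrolling the last equation of \<open>ehook\<close> trades one unit of exponent for one
  more index until the exponent is 1. For r = 0 this is Newton's identity.\<close>

lemma ehook_newton:
  "ehook r (Suc j) = (\<Sum>t<j. (- 1) ^ t * egen (r + Suc t) * ehook 0 (j - t)) +
     (- 1) ^ j * of_nat (r + Suc j) * egen (r + Suc j)"
proof (induction j arbitrary: r)
  case (Suc j)
  show ?case
    unfolding sum.lessThan_Suc_shift ehook.simps(3) Suc.IH[of "Suc r"]
    by (simp add: sum_negf del: ehook.simps of_nat_Suc of_nat_add)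
qed simp

definition epow :: "nat \<Rightarrow> epoly" where
  "epow n = ehook 0 n"

lemma epoly_eval_epow: "n > 0 \<Longrightarrow> epoly_eval esym (epow n) = power_sum n"
  using epoly_eval_ehook[of 0 "n - 1"] by (simp add: epow_def hook_monomial_0)

lemma homog_epow: "n > 0 \<Longrightarrow> homog n (epow n)"
  using homog_ehook[of 0 "n - 1"] by (simp add: epow_def)

lemma epow_newton:
  "epow (Suc j) = (\<Sum>t<j. (- 1) ^ t * egen (Suc t) * epow (j - t)) +
     (- 1) ^ j * of_nat (Suc j) * egen (Suc j)"
  using ehook_newton[of 0 j] unfolding epow_def add_0 .


section \<open>Uniqueness of the elementary expansion\<close>

lemma lookup_set_monomial:
  "finite S \<Longrightarrow> Poly_Mapping.lookup (set_monomial S) i = of_bool (i \<in> S)"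
  using lookup_sum_single[of S "\<lambda>i. i" i] by (cases "i \<in> S") (auto simp: Collect_conv_if)

lemma sum_lookup_set_monomial:
  "finite S \<Longrightarrow> (\<Sum>j<r. Poly_Mapping.lookup (set_monomial S) j) = card (S \<inter> {..<r})"
  by (simp add: lookup_set_monomial sum.If_cases of_bool_def Int_commute del: One_nat_def)

lemma mfps_nth_esym_partition_nonneg: "0 \<le> mfps_nth (esym_partition q) m"
proof (induction q arbitrary: m)
  case (Cons k q)
  then show ?case
    by (auto simp: esym_partition_def mfps_nth_times esym_def mfps_nth_monomial_series intro!: sum_nonneg)
qed (simp add: esym_partition_def mfps_nth_one)

text \<open>
  The right-hand side is the sum of the first \<open>r\<close> parts of the conjugate partition, so the monomials
  of \<open>esym_partition q\<close> are dominated by the conjugate of \<open>q\<close>.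
\<close>

lemma esym_partition_dominance:
  "mfps_nth (esym_partition q) m \<noteq> 0 \<Longrightarrow>
    (\<Sum>j<r. Poly_Mapping.lookup m j) \<le> sum_list (map (min r) q)"
proof (induction q arbitrary: m)
  case Nil
  then show ?case
    by (simp add: esym_partition_def mfps_nth_one split: if_splits)
next
  case (Cons k q)
  then have "(\<Sum>(a, b) | a + b = m. mfps_nth (esym k) a * mfps_nth (esym_partition q) b) \<noteq> 0"
    by (simp add: esym_partition_def mfps_nth_times)
  then obtain x where "x \<in> {(a, b). a + b = m}"
      "(case x of (a, b) \<Rightarrow> mfps_nth (esym k) a * mfps_nth (esym_partition q) b) \<noteq> 0"
    by (rule sum.not_neutral_contains_not_neutral)
  then obtain a b where m: "m = a + b" and a: "mfps_nth (esym k) a \<noteq> 0"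
    and b: "mfps_nth (esym_partition q) b \<noteq> 0"
    by auto
  from a have "card {S \<in> {S. finite S \<and> card S = k}. set_monomial S = a} \<noteq> 0"
    by (simp add: esym_def mfps_nth_monomial_series)
  then have "{S \<in> {S. finite S \<and> card S = k}. set_monomial S = a} \<noteq> {}"
    by (metis card.empty)
  then obtain S where S: "finite S" "card S = k" "set_monomial S = a"
    by auto
  have "(\<Sum>j<r. Poly_Mapping.lookup a j) = card (S \<inter> {..<r})"
    using S sum_lookup_set_monomial by blast
  also have "\<dots> \<le> min r k"
    using S card_mono[of S "S \<inter> {..<r}"] card_mono[of "{..<r}" "S \<inter> {..<r}"] by auto
  finally show ?case
    unfolding m lookup_add sum.distrib list.map sum_list.Cons by (rule add_mono[OF _ Cons.IH[OF b]])
qed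

text \<open>The exponent vector is the conjugate partition of p: this is the leading monomial of e_p
  in dominance order.\<close>

definition conj_monomial :: "nat list \<Rightarrow> (nat \<Rightarrow>\<^sub>0 nat)" where
  "conj_monomial p = sum_list (map (\<lambda>k. set_monomial {..<k}) p)"

lemma sum_lookup_conj_monomial:
  "(\<Sum>j<r. Poly_Mapping.lookup (conj_monomial p) j) = sum_list (map (min r) p)"
proof (induction p)
  case (Cons k p)
  have "{..<k} \<inter> {..<r} = {..<min r k}"
    by auto
  then have "(\<Sum>j<r. Poly_Mapping.lookup (set_monomial {..<k}) j) = min r k"
    using sum_lookup_set_monomial[of "{..<k}" r] by simp
  then show ?case
    using Cons by (simp add: conj_monomial_def lookup_add sum.distrib)
qed (simp add: conj_monomial_def)

lemma mfps_nth_conj_monomial: "0 < mfps_nth (esym_partition p) (conj_monomial p)"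
proof (induction p)
  case (Cons k p)
  let ?g = "\<lambda>x. mfps_nth (esym k) (fst x) * mfps_nth (esym_partition p) (snd x)"
  let ?x = "(set_monomial {..<k}, conj_monomial p)"
  let ?m = "conj_monomial (k # p)"
  have "{S \<in> {S. finite S \<and> card S = k}. set_monomial S = set_monomial {..<k}} \<noteq> {}"
    by (auto intro!: exI[of _ "{..<k}"])
  then have "0 < mfps_nth (esym k) (set_monomial {..<k})"
    unfolding esym_def mfps_nth_monomial_series
    using finite_sets_with_monomial[of k "set_monomial {..<k}"] by (simp only: card_gt_0_iff of_nat_0_less_iff) simp
  then have "0 < ?g ?x"
    using Cons by simp
  also have "?g ?x \<le> (\<Sum>x\<in>{(a, b). a + b = ?m}. ?g x)"
  proof (rule member_le_sum[OF _ _ finite_monomial_splits])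
    show "?x \<in> {(a, b). a + b = ?m}"
      by (simp add: conj_monomial_def)
    show "0 \<le> ?g x" for x
      by (simp add: mfps_nth_esym_partition_nonneg esym_def mfps_nth_monomial_series)
  qed
  also have "\<dots> = mfps_nth (esym_partition (k # p)) ?m"
    by (simp add: esym_partition_def mfps_nth_times case_prod_unfold)
  finally show ?case .
qed (simp add: esym_partition_def conj_monomial_def mfps_nth_one)

lemma sum_list_min_Suc:
  "sum_list (map (min (Suc r)) p) = sum_list (map (min r) p) + length (filter (\<lambda>x. r < x) p)"
  by (induction p) auto

text \<open>Differences of these sums in r are the parts of the conjugate, and differences of those
  are the multiplicities of the parts.\<close>

lemma partition_eqI:
  assumes "p \<in> partitions_of n" "q \<in> partitions_of n"
    "\<And>r. r \<le> n \<Longrightarrow> sum_list (map (min r) p) = sum_list (map (min r) q)"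
  shows "p = q"
proof -
  have large: "length (filter (\<lambda>x. r < x) u) = 0" if "u \<in> partitions_of n" "n \<le> r" for u r
  proof -
    have "x \<le> n" if "x \<in> set u" for x
      using that member_le_sum_list[of x u] \<open>u \<in> _\<close> by (simp add: partitions_of_def)
    then show ?thesis
      using that(2) by (fastforce simp: filter_empty_conv)
  qed
  have gt: "length (filter (\<lambda>x. r < x) p) = length (filter (\<lambda>x. r < x) q)" for r
  proof (cases "r < n")
    case True
    then show ?thesis
      using assms(3)[of r] assms(3)[of "Suc r"] by (simp add: sum_list_min_Suc)
  next
    case False
    then show ?thesis
      using large assms by simp
  qed
  have count: "count (mset u) (Suc r) + length (filter (\<lambda>x. Suc r < x) u) = length (filter (\<lambda>x. r < x) u)"
    for r and u :: "nat list"
    by (induction u) auto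
  have zero: "count (mset u) 0 = 0" if "u \<in> partitions_of n" for u
    using that by (auto simp: partitions_of_def is_partition_def count_eq_zero_iff)
  have "mset p = mset q"
  proof (rule multiset_eqI)
    fix x
    show "count (mset p) x = count (mset q) x"
    proof (cases x)
      case 0
      then show ?thesis
        using zero[OF assms(1)] zero[OF assms(2)] by (simp only:)
    next
      case (Suc r)
      then show ?thesis
        using count[of p r] count[of q r] gt[of r] gt[of "Suc r"] by simp
    qed
  qed
  moreover have "sorted (rev p)" "sorted (rev q)"
    using assms by (auto simp: partitions_of_def is_partition_def sorted_wrt_rev)
  ultimately have "rev p = rev q"
    by (metis mset_rev properties_for_sort)
  then show ?thesis
    by simp
qed

text \<open>Triangularity in dominance order: if p in the support has a maximal conjugate, its
  leading monomial occurs in no other e_u of the support.\<close>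

lemma esym_partitions_independent:
  assumes "(\<Sum>p\<in>partitions_of n. of_int (c p) * esym_partition p) = 0" "q \<in> partitions_of n"
  shows "c q = 0"
proof (rule ccontr)
  assume "c q \<noteq> 0"
  let ?S = "{p \<in> partitions_of n. c p \<noteq> 0}"
  \<comment> \<open>A single number monotone in dominance: its maximum picks a maximal element, and
    equal totals force equality of every summand.\<close>
  let ?h = "\<lambda>p. \<Sum>r\<le>n. sum_list (map (min r) p)"
  have fin: "finite (?h ` ?S)" and "?h ` ?S \<noteq> {}"
    using finite_partitions_of[of n] assms(2) \<open>c q \<noteq> 0\<close> by auto
  then have "Max (?h ` ?S) \<in> ?h ` ?S"
    by (rule Max_in)
  then obtain p where p: "p \<in> ?S" "?h p = Max (?h ` ?S)"
    by auto
  have max: "?h u \<le> ?h p" if "u \<in> ?S" for u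
    unfolding p(2) using that fin by (intro Max_ge) auto
  have "c u * mfps_nth (esym_partition u) (conj_monomial p) = 0"
    if u: "u \<in> partitions_of n - {p}" for u
  proof (rule ccontr)
    assume nz: "c u * mfps_nth (esym_partition u) (conj_monomial p) \<noteq> 0"
    then have le: "sum_list (map (min r) p) \<le> sum_list (map (min r) u)" for r
      using esym_partition_dominance[of u "conj_monomial p" r] by (simp add: sum_lookup_conj_monomial)
    have "?h p \<le> ?h u"
      by (intro sum_mono le)
    moreover have "?h u \<le> ?h p"
      using nz u by (intro max) auto
    ultimately have "?h p = ?h u"
      by (rule antisym)
    then have "sum_list (map (min r) p) = sum_list (map (min r) u)" if "r \<le> n" for r
      using le that by (intro sum_mono_inv[of "\<lambda>r. sum_list (map (min r) p)" "{..n}"]) auto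
    then have "p = u"
      using p u by (intro partition_eqI[of p n u]) auto
    then show False
      using u by simp
  qed
  then have "(\<Sum>u\<in>partitions_of n - {p}. c u * mfps_nth (esym_partition u) (conj_monomial p)) = 0"
    by (intro sum.neutral) blast
  then have "(\<Sum>u\<in>partitions_of n. c u * mfps_nth (esym_partition u) (conj_monomial p)) =
      c p * mfps_nth (esym_partition p) (conj_monomial p)"
    using p finite_partitions_of[of n] by (simp add: sum.remove[of _ p])
  moreover have "(\<Sum>u\<in>partitions_of n. c u * mfps_nth (esym_partition u) (conj_monomial p)) = 0"
    using arg_cong[OF assms(1), of "\<lambda>F. mfps_nth F (conj_monomial p)"]
    by (simp add: mfps_nth_sum mfps_nth_of_int_times)
  ultimately show False
    using p mfps_nth_conj_monomial[of p] by simp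
qed

lemma bij_betw_mset_partitions:
  "bij_betw mset (partitions_of n) {M. sum_mset M = n \<and> 0 \<notin># M}"
proof (rule bij_betw_byWitness[where f' = "\<lambda>M. rev (sorted_list_of_multiset M)"])
  show "\<forall>p\<in>partitions_of n. rev (sorted_list_of_multiset (mset p)) = p"
  proof
    fix p assume "p \<in> partitions_of n"
    then have "sorted (rev p)"
      by (simp add: partitions_of_def is_partition_def sorted_wrt_rev)
    then have "sort p = rev p"
      by (intro properties_for_sort) auto
    then show "rev (sorted_list_of_multiset (mset p)) = p"
      by simp
  qed
  show "(\<lambda>M. rev (sorted_list_of_multiset M)) ` {M. sum_mset M = n \<and> 0 \<notin># M} \<subseteq> partitions_of n"
  proof (rule image_subsetI)
    fix M assume M: "M \<in> {M. sum_mset M = n \<and> 0 \<notin># M}"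
    have "sum_list (sorted_list_of_multiset M) = sum_mset M"
      by (metis mset_sorted_list_of_multiset sum_mset_sum_list)
    then show "rev (sorted_list_of_multiset M) \<in> partitions_of n"
      using M by (auto simp: partitions_of_def is_partition_def sorted_wrt_rev intro!: Nat.gr0I)
  qed
qed (auto simp: partitions_of_def is_partition_def sum_mset_sum_list)

lemma epoly_eval_esym:
  assumes "homog n F"
  shows "epoly_eval esym F = (\<Sum>p\<in>partitions_of n. of_int (Poly_Mapping.lookup F (mset p)) * esym_partition p)"
proof -
  let ?S = "{M. sum_mset M = n \<and> 0 \<notin># M}"
  have fin: "finite ?S"
    using bij_betw_finite[OF bij_betw_mset_partitions] finite_partitions_of by blast
  have "epoly_eval esym F = (\<Sum>M\<in>?S. of_int (Poly_Mapping.lookup F M) * prod_mset (image_mset esym M))"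
    using assms fin by (intro epoly_eval_superset) (auto simp: homog_def)
  also have "\<dots> = (\<Sum>p\<in>partitions_of n. of_int (Poly_Mapping.lookup F (mset p)) * prod_mset (image_mset esym (mset p)))"
    by (rule sum.reindex_bij_betw[OF bij_betw_mset_partitions, symmetric])
  finally show ?thesis
    by (simp add: esym_partition_def prod_mset_prod_list flip: mset_map)
qed

text \<open>Independence of the e_p, one degree at a time. It lifts identities of power series to
  polynomials, where coefficients can be read.\<close>

lemma epoly_eval_esym_inj:
  assumes "homog n F" "homog n G" "epoly_eval esym F = epoly_eval esym G"
  shows "F = G"
proof -
  have hom: "homog n (F - G)" and ev: "epoly_eval esym (F - G) = 0"
    using assms by (auto intro: homog_diff)
  have zero: "Poly_Mapping.lookup (F - G) (mset p) = 0" if "p \<in> partitions_of n" for p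
    using ev that unfolding epoly_eval_esym[OF hom] by (rule esym_partitions_independent)
  have "Poly_Mapping.keys (F - G) = {}"
  proof (rule ccontr)
    assume "Poly_Mapping.keys (F - G) \<noteq> {}"
    then obtain M where M: "M \<in> Poly_Mapping.keys (F - G)"
      by blast
    then have "M \<in> {M. sum_mset M = n \<and> 0 \<notin># M}"
      using hom by (auto simp: homog_def)
    then obtain p where "p \<in> partitions_of n" "M = mset p"
      using bij_betw_mset_partitions[of n] unfolding bij_betw_def by blast
    then show False
      using zero M by (simp add: in_keys_iff)
  qed
  then show ?thesis
    by simp
qed


section \<open>Chromatic symmetric functions of induced subgraphs\<close>

definition colourings :: "('v \<times> 'v) set \<Rightarrow> 'v set \<Rightarrow> ('v \<Rightarrow> nat) set" where
  "colourings E V = {\<chi> \<in> V \<rightarrow>\<^sub>E UNIV. \<forall>u\<in>V. \<forall>w\<in>V. (u, w) \<in> E \<longrightarrow> \<chi> u \<noteq> \<chi> w}"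

abbreviation colour_monomial :: "'v set \<Rightarrow> ('v \<Rightarrow> nat) \<Rightarrow> (nat \<Rightarrow>\<^sub>0 nat)" where
  "colour_monomial V \<chi> \<equiv> \<Sum>v\<in>V. Poly_Mapping.single (\<chi> v) 1"

text \<open>E stays fixed while V shrinks, so inductions run over the induced subgraphs of one
  graph.\<close>

definition csf :: "('v \<times> 'v) set \<Rightarrow> 'v set \<Rightarrow> int mfps" where
  "csf E V = monomial_series (colourings E V) (colour_monomial V)"

lemma chromatic_sf_csf:
  assumes "pair_graph G"
  shows "chromatic_sf G = csf (parcs G) (pverts G)"
proof -
  have "parcs G \<subseteq> pverts G \<times> pverts G"
    using assms by (simp add: pair_graph_iff)
  then have "proper_colourings G = colourings (parcs G) (pverts G)"
    unfolding proper_colourings_def colourings_def by (intro Collect_cong) auto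
  then show ?thesis
    by (simp add: chromatic_sf_def csf_def)
qed

lemma finite_colour_monomial_fibre:
  fixes V :: "'v set"
  assumes "finite V"
  shows "finite {\<chi> \<in> V \<rightarrow>\<^sub>E UNIV. colour_monomial V \<chi> = m}"
proof -
  \<comment> \<open>Without edges every map is a proper colouring, so the finiteness result for
    graphs covers all maps.\<close>
  let ?G = "\<lparr>pverts = V, parcs = {}\<rparr>"
  have "pair_graph ?G"
    using assms by (simp add: pair_graph_iff sym_def irrefl_def)
  then show ?thesis
    using finite_colourings_with_monomial[of ?G m] by (simp add: proper_colourings_def)
qed

lemma finite_colourings_fibre:
  "finite V \<Longrightarrow> finite {\<chi> \<in> colourings E V. colour_monomial V \<chi> = m}"
  by (rule finite_subset[OF _ finite_colour_monomial_fibre[of V m]]) (auto simp: colourings_def)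

lemma csf_empty: "csf E {} = 1"
proof (rule mfps_eqI)
  fix m :: "nat \<Rightarrow>\<^sub>0 nat"
  have "{\<chi> \<in> colourings E {}. colour_monomial {} \<chi> = m} = (if m = 0 then {\<lambda>_. undefined} else {})"
    by (auto simp: colourings_def)
  then show "mfps_nth (csf E {}) m = mfps_nth 1 m"
    unfolding csf_def mfps_nth_monomial_series by (simp add: mfps_nth_one)
qed

lemma csf_Un:
  assumes "finite A" "finite B" "A \<inter> B = {}" "sym E" "\<And>a b. a \<in> A \<Longrightarrow> b \<in> B \<Longrightarrow> (a, b) \<notin> E"
  shows "csf E (A \<union> B) = csf E A * csf E B"
proof -
  let ?g = "\<lambda>(\<chi>, \<psi>) x. if x \<in> A then \<chi> x else \<psi> x"
  have bij: "bij_betw ?g (colourings E A \<times> colourings E B) (colourings E (A \<union> B))"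
  proof (rule bij_betw_byWitness[where f' = "\<lambda>\<chi>. (restrict \<chi> A, restrict \<chi> B)"])
    show "\<forall>x\<in>colourings E A \<times> colourings E B. (restrict (?g x) A, restrict (?g x) B) = x"
      using assms(3) by (auto simp: colourings_def PiE_def extensional_def fun_eq_iff)
    show "\<forall>\<chi>\<in>colourings E (A \<union> B). ?g (restrict \<chi> A, restrict \<chi> B) = \<chi>"
      by (auto simp: colourings_def PiE_def extensional_def fun_eq_iff)
    show "?g ` (colourings E A \<times> colourings E B) \<subseteq> colourings E (A \<union> B)"
    proof -
      have "b \<notin> A" if "b \<in> B" for b
        using that assms(3) by auto
      moreover have "(b, a) \<notin> E" if "a \<in> A" "b \<in> B" for a b
        using that assms(4,5) by (auto dest: symD)
      ultimately show ?thesis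
        using assms(5) by (auto simp: colourings_def PiE_def extensional_def)
    qed
    show "(\<lambda>\<chi>. (restrict \<chi> A, restrict \<chi> B)) ` colourings E (A \<union> B) \<subseteq> colourings E A \<times> colourings E B"
      by (auto simp: colourings_def)
  qed
  have mon: "colour_monomial (A \<union> B) (?g x) =
      (case x of (\<chi>, \<psi>) \<Rightarrow> colour_monomial A \<chi> + colour_monomial B \<psi>)" for x
  proof -
    have "(\<Sum>v\<in>B. Poly_Mapping.single (?g x v) 1) = (\<Sum>v\<in>B. Poly_Mapping.single (snd x v) (1 :: nat))"
      using assms(3) by (intro sum.cong) (auto simp: case_prod_unfold)
    moreover have "(\<Sum>v\<in>A. Poly_Mapping.single (?g x v) 1) = (\<Sum>v\<in>A. Poly_Mapping.single (fst x v) (1 :: nat))"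
      by (intro sum.cong) (auto simp: case_prod_unfold)
    ultimately show ?thesis
      using assms(1-3) by (simp add: sum.union_disjoint case_prod_unfold)
  qed
  show ?thesis
    unfolding csf_def monomial_series_times[OF finite_colourings_fibre finite_colourings_fibre, OF assms(1,2)]
    by (rule monomial_series_bij_betw[OF bij, symmetric]) (rule mon)
qed

text \<open>Nothing relates the colour of W to the colours on V - W, not even along edges; hence the
  series factors as \<open>power_sum (card W)\<close> times \<open>csf E (V - W)\<close>.\<close>

definition block_colourings :: "('v \<times> 'v) set \<Rightarrow> 'v set \<Rightarrow> 'v \<Rightarrow> 'v set \<Rightarrow> ('v \<Rightarrow> nat) set" where
  "block_colourings E V v W = {\<chi> \<in> V \<rightarrow>\<^sub>E UNIV.
     (\<forall>w\<in>W. \<chi> w = \<chi> v) \<and> (\<forall>u\<in>V - W. \<forall>w\<in>V - W. (u, w) \<in> E \<longrightarrow> \<chi> u \<noteq> \<chi> w)}"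

lemma power_sum_times_csf:
  assumes "finite V" "v \<in> W" "W \<subseteq> V"
  shows "power_sum (card W) * csf E (V - W) = monomial_series (block_colourings E V v W) (colour_monomial V)"
proof -
  let ?g = "\<lambda>(i, \<chi>) x. if x \<in> W then i else \<chi> x"
  have "finite W"
    using assms finite_subset by blast
  then have pos: "0 < card W"
    using assms by (auto simp: card_gt_0_iff)
  have bij: "bij_betw ?g (UNIV \<times> colourings E (V - W)) (block_colourings E V v W)"
  proof (rule bij_betw_byWitness[where f' = "\<lambda>\<chi>. (\<chi> v, restrict \<chi> (V - W))"])
    show "\<forall>x\<in>UNIV \<times> colourings E (V - W). (?g x v, restrict (?g x) (V - W)) = x"
      using assms by (auto simp: colourings_def PiE_def extensional_def fun_eq_iff)
    show "\<forall>\<chi>\<in>block_colourings E V v W. ?g (\<chi> v, restrict \<chi> (V - W)) = \<chi>"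
      by (auto simp: block_colourings_def PiE_def extensional_def fun_eq_iff)
    show "?g ` (UNIV \<times> colourings E (V - W)) \<subseteq> block_colourings E V v W"
      using assms by (auto simp: colourings_def block_colourings_def PiE_def extensional_def)
    show "(\<lambda>\<chi>. (\<chi> v, restrict \<chi> (V - W))) ` block_colourings E V v W \<subseteq> UNIV \<times> colourings E (V - W)"
      by (auto simp: colourings_def block_colourings_def)
  qed
  have mon: "colour_monomial V (?g x) =
      (case x of (i, \<chi>) \<Rightarrow> Poly_Mapping.single i (card W) + colour_monomial (V - W) \<chi>)" for x
  proof -
    have "(\<Sum>u\<in>V - W. Poly_Mapping.single (?g x u) 1) = (\<Sum>u\<in>V - W. Poly_Mapping.single (snd x u) (1 :: nat))"
      by (intro sum.cong) (auto simp: case_prod_unfold)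
    moreover have "(\<Sum>u\<in>W. Poly_Mapping.single (?g x u) 1) = (\<Sum>u\<in>W. Poly_Mapping.single (fst x) (1 :: nat))"
      by (intro sum.cong) (auto simp: case_prod_unfold)
    moreover have "(\<Sum>u\<in>W. Poly_Mapping.single (fst x) (1 :: nat)) = Poly_Mapping.single (fst x) (card W)"
      using \<open>finite W\<close>
      by (induction W rule: finite_induct) (auto simp del: sum_constant simp flip: single_add)
    ultimately show ?thesis
      using assms(1,3) by (simp add: sum.subset_diff[of W V] case_prod_unfold add.commute)
  qed
  have fin: "finite {\<chi> \<in> colourings E (V - W). colour_monomial (V - W) \<chi> = m}" for m
    using assms(1) by (intro finite_colourings_fibre) auto
  show ?thesis
    unfolding csf_def power_sum_def monomial_series_times[OF finite_power_sum_fibre[OF pos] fin]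
    by (rule monomial_series_bij_betw[OF bij]) (rule mon)
qed

section \<open>The power-sum recursion for chromatic symmetric functions\<close>

context
  fixes E :: "('v \<times> 'v) set"
  assumes sym_E: "sym E" and irrefl_E: "irrefl E"
begin

text \<open>
  Only sets \<open>W\<close> inside the colour class of \<open>v\<close> contribute, so this is \<open>slog0_rec\<close> for that class.
\<close>

lemma block_colourings_sum:
  assumes "finite V" "v \<in> V" "\<chi> \<in> V \<rightarrow>\<^sub>E UNIV"
  shows "(\<Sum>W | v \<in> W \<and> W \<subseteq> V. slog0 (ind E) W * of_bool (\<chi> \<in> block_colourings E V v W)) =
    of_bool (\<chi> \<in> colourings E V)"
proof -
  define C where "C = {x \<in> V. \<chi> x = \<chi> v}"
  \<comment> \<open>R gathers the conditions outside the colour class C, which do not depend on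
    W.\<close>
  define R where "R \<longleftrightarrow> (\<forall>u\<in>V - C. \<forall>w\<in>V - C. (u, w) \<in> E \<longrightarrow> \<chi> u \<noteq> \<chi> w)"
  have C: "finite C" "v \<in> C" "C \<subseteq> V"
    using assms by (auto simp: C_def)
  have split: "(\<forall>u\<in>V - W. \<forall>w\<in>V - W. (u, w) \<in> E \<longrightarrow> \<chi> u \<noteq> \<chi> w) \<longleftrightarrow>
      (\<forall>u\<in>C - W. \<forall>w\<in>C - W. (u, w) \<notin> E) \<and> R" if "W \<subseteq> C" for W
  proof (rule iffI)
    assume L: "\<forall>u\<in>V - W. \<forall>w\<in>V - W. (u, w) \<in> E \<longrightarrow> \<chi> u \<noteq> \<chi> w"
    have "(u, w) \<notin> E" if "u \<in> C - W" "w \<in> C - W" for u w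
    proof -
      have "u \<in> V - W" "w \<in> V - W" "\<chi> u = \<chi> w"
        using that by (auto simp: C_def)
      then show ?thesis
        using L by blast
    qed
    moreover have R
      unfolding R_def using L that by blast
    ultimately show "(\<forall>u\<in>C - W. \<forall>w\<in>C - W. (u, w) \<notin> E) \<and> R"
      by blast
  next
    assume CR: "(\<forall>u\<in>C - W. \<forall>w\<in>C - W. (u, w) \<notin> E) \<and> R"
    have "\<chi> u \<noteq> \<chi> w" if uw: "u \<in> V - W" "w \<in> V - W" "(u, w) \<in> E" for u w
    proof
      assume eq: "\<chi> u = \<chi> w"
      then have "u \<in> C \<longleftrightarrow> w \<in> C"
        using uw by (auto simp: C_def)
      then show False
        using CR uw eq unfolding R_def by blast
    qed
    then show "\<forall>u\<in>V - W. \<forall>w\<in>V - W. (u, w) \<in> E \<longrightarrow> \<chi> u \<noteq> \<chi> w"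
      by blast
  qed
  have "(\<Sum>W | v \<in> W \<and> W \<subseteq> V. slog0 (ind E) W * of_bool (\<chi> \<in> block_colourings E V v W)) =
      (\<Sum>W | v \<in> W \<and> W \<subseteq> C. slog0 (ind E) W * of_bool (\<chi> \<in> block_colourings E V v W))"
  proof (rule sum.mono_neutral_right)
    show "finite {W. v \<in> W \<and> W \<subseteq> V}"
      using assms(1) by (auto intro: finite_subset[of _ "Pow V"])
    show "{W. v \<in> W \<and> W \<subseteq> C} \<subseteq> {W. v \<in> W \<and> W \<subseteq> V}"
      using C by auto
    show "\<forall>W\<in>{W. v \<in> W \<and> W \<subseteq> V} - {W. v \<in> W \<and> W \<subseteq> C}.
        slog0 (ind E) W * of_bool (\<chi> \<in> block_colourings E V v W) = 0"
    proof
      fix W assume W: "W \<in> {W. v \<in> W \<and> W \<subseteq> V} - {W. v \<in> W \<and> W \<subseteq> C}"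
      then have "\<not> (\<forall>w\<in>W. \<chi> w = \<chi> v)"
        unfolding C_def by blast
      then have "\<chi> \<notin> block_colourings E V v W"
        unfolding block_colourings_def by blast
      then show "slog0 (ind E) W * of_bool (\<chi> \<in> block_colourings E V v W) = 0"
        by simp
    qed
  qed
  also have "\<dots> = (\<Sum>W | v \<in> W \<and> W \<subseteq> C. slog0 (ind E) W * ind E (C - W) * of_bool R)"
  proof (rule sum.cong[OF refl])
    fix W assume "W \<in> {W. v \<in> W \<and> W \<subseteq> C}"
    then have "W \<subseteq> C" and const: "\<forall>w\<in>W. \<chi> w = \<chi> v"
      unfolding C_def by blast+
    have "\<chi> \<in> block_colourings E V v W \<longleftrightarrow> (\<forall>u\<in>C - W. \<forall>w\<in>C - W. (u, w) \<notin> E) \<and> R"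
      unfolding block_colourings_def using assms(3) const split[OF \<open>W \<subseteq> C\<close>] by blast
    then show "slog0 (ind E) W * of_bool (\<chi> \<in> block_colourings E V v W) =
        slog0 (ind E) W * ind E (C - W) * of_bool R"
      by (simp add: ind_def of_bool_conj)
  qed
  also have "\<dots> = ind E C * of_bool R"
    using slog0_rec[of C v "ind E"] C by (simp add: sum_distrib_right)
  also have "\<dots> = of_bool (\<chi> \<in> colourings E V)"
    using split[of "{}"] assms(3) by (simp add: colourings_def ind_def of_bool_conj)
  finally show ?thesis .
qed

text \<open>For a fixed monomial only finitely many maps matter, so the sums over W and over maps
  can be exchanged; \<open>block_colourings_sum\<close> then evaluates the inner sum for each
  map.\<close>

lemma csf_rec:
  assumes "finite V" "v \<in> V"
  shows "csf E V = (\<Sum>W | v \<in> W \<and> W \<subseteq> V.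
    of_int (slog0 (ind E) W) * (power_sum (card W) * csf E (V - W)))"
proof (rule mfps_eqI)
  fix m
  let ?C = "{\<chi> \<in> V \<rightarrow>\<^sub>E UNIV. colour_monomial V \<chi> = m}"
  have fin: "finite ?C"
    using finite_colour_monomial_fibre[OF assms(1)] .
  have count: "int (card {\<chi> \<in> S. colour_monomial V \<chi> = m}) = (\<Sum>\<chi>\<in>?C. of_bool (\<chi> \<in> S))"
    if "S \<subseteq> V \<rightarrow>\<^sub>E UNIV" for S
  proof -
    have "{\<chi> \<in> S. colour_monomial V \<chi> = m} = ?C \<inter> {\<chi>. \<chi> \<in> S}"
      using that by auto
    then show ?thesis
      using fin by (simp only: sum_of_bool_eq)
  qed
  have "mfps_nth (\<Sum>W | v \<in> W \<and> W \<subseteq> V. of_int (slog0 (ind E) W) * (power_sum (card W) * csf E (V - W))) m =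
      (\<Sum>W | v \<in> W \<and> W \<subseteq> V. slog0 (ind E) W * (\<Sum>\<chi>\<in>?C. of_bool (\<chi> \<in> block_colourings E V v W)))"
    unfolding mfps_nth_sum
  proof (rule sum.cong[OF refl])
    fix W assume "W \<in> {W. v \<in> W \<and> W \<subseteq> V}"
    then have eq: "power_sum (card W) * csf E (V - W) =
        monomial_series (block_colourings E V v W) (colour_monomial V)"
      using assms by (intro power_sum_times_csf) auto
    have sub: "block_colourings E V v W \<subseteq> V \<rightarrow>\<^sub>E UNIV"
      by (auto simp: block_colourings_def)
    show "mfps_nth (of_int (slog0 (ind E) W) * (power_sum (card W) * csf E (V - W))) m =
        slog0 (ind E) W * (\<Sum>\<chi>\<in>?C. of_bool (\<chi> \<in> block_colourings E V v W))"
      unfolding mfps_nth_of_int_times eq mfps_nth_monomial_series count[OF sub] ..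
  qed
  also have "\<dots> = (\<Sum>\<chi>\<in>?C. \<Sum>W | v \<in> W \<and> W \<subseteq> V. slog0 (ind E) W * of_bool (\<chi> \<in> block_colourings E V v W))"
    unfolding sum_distrib_left by (rule sum.swap)
  also have "\<dots> = (\<Sum>\<chi>\<in>?C. of_bool (\<chi> \<in> colourings E V))"
    using assms by (intro sum.cong refl block_colourings_sum) auto
  also have "\<dots> = mfps_nth (csf E V) m"
    unfolding csf_def mfps_nth_monomial_series by (rule count[symmetric]) (auto simp: colourings_def)
  finally show "mfps_nth (csf E V) m = mfps_nth (\<Sum>W | v \<in> W \<and> W \<subseteq> V.
      of_int (slog0 (ind E) W) * (power_sum (card W) * csf E (V - W))) m"
    by simp
qed

text \<open>Induction along \<open>csf_rec\<close>; the coefficients stay integral because Newton's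
  identities express p_n in the e_i without division.\<close>

lemma csf_epoly_exists:
  "finite V \<Longrightarrow> \<exists>F. homog (card V) F \<and> epoly_eval esym F = csf E V"
proof (induction V rule: finite_psubset_induct)
  case (psubset V)
  show ?case
  proof (cases "V = {}")
    case True
    then show ?thesis
      using csf_empty[of E] by (intro exI[of _ 1]) simp
  next
    case False
    then obtain v where v: "v \<in> V"
      by auto
    have "\<exists>F. v \<in> W \<and> W \<subseteq> V \<longrightarrow> homog (card (V - W)) F \<and> epoly_eval esym F = csf E (V - W)" for W
      using psubset.IH[of "V - W"] v by blast
    then obtain F where F: "\<And>W. v \<in> W \<and> W \<subseteq> V \<Longrightarrow>
        homog (card (V - W)) (F W) \<and> epoly_eval esym (F W) = csf E (V - W)"
      by metis
    let ?F = "\<Sum>W | v \<in> W \<and> W \<subseteq> V. of_int (slog0 (ind E) W) * (epow (card W) * F W)"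
    have W: "0 < card W" "card W + card (V - W) = card V" if "v \<in> W \<and> W \<subseteq> V" for W
      using that psubset.hyps finite_subset[of W V] card_mono[of V W]
      by (auto simp: card_gt_0_iff card_Diff_subset)
    have "homog (card V) ?F"
    proof (rule homog_sum)
      fix W assume "W \<in> {W. v \<in> W \<and> W \<subseteq> V}"
      then have "homog (0 + (card W + card (V - W))) (of_int (slog0 (ind E) W) * (epow (card W) * F W))"
        using F W by (intro homog_times homog_of_int homog_epow) auto
      then show "homog (card V) (of_int (slog0 (ind E) W) * (epow (card W) * F W))"
        using W \<open>W \<in> _\<close> by simp
    qed
    moreover have "epoly_eval esym ?F = csf E V"
      unfolding csf_rec[OF psubset.hyps v] using F W
      by (auto simp: epoly_eval_sum epoly_eval_epow intro!: sum.cong)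
    ultimately show ?thesis
      by blast
  qed
qed

end

definition cpoly :: "('v \<times> 'v) set \<Rightarrow> 'v set \<Rightarrow> epoly" where
  "cpoly E V = (SOME F. homog (card V) F \<and> epoly_eval esym F = csf E V)"

section \<open>The lift of chromatic symmetric functions to polynomials in the e_i\<close>

context
  fixes E :: "('v \<times> 'v) set"
  assumes sym_E: "sym E" and irrefl_E: "irrefl E"
begin

lemma cpoly:
  assumes "finite V"
  shows homog_cpoly: "homog (card V) (cpoly E V)"
    and epoly_eval_cpoly: "epoly_eval esym (cpoly E V) = csf E V"
  using someI_ex[OF csf_epoly_exists[OF sym_E irrefl_E assms]] by (simp_all add: cpoly_def)

lemma cpoly_eqI:
  "finite V \<Longrightarrow> homog (card V) F \<Longrightarrow> epoly_eval esym F = csf E V \<Longrightarrow> cpoly E V = F"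
  by (rule epoly_eval_esym_inj[of "card V"]) (simp_all add: cpoly)

lemma cpoly_empty: "cpoly E {} = 1"
  by (rule cpoly_eqI) (simp_all add: csf_empty)

lemma cpoly_rec:
  assumes "finite V" "v \<in> V"
  shows "cpoly E V = (\<Sum>W | v \<in> W \<and> W \<subseteq> V. of_int (slog0 (ind E) W) * (epow (card W) * cpoly E (V - W)))"
    (is "_ = ?F")
proof (rule cpoly_eqI)
  have W: "0 < card W" "card W + card (V - W) = card V" if "v \<in> W \<and> W \<subseteq> V" for W
    using that assms finite_subset[of W V] card_mono[of V W]
    by (auto simp: card_gt_0_iff card_Diff_subset)
  show "homog (card V) ?F"
  proof (rule homog_sum)
    fix W assume "W \<in> {W. v \<in> W \<and> W \<subseteq> V}"
    then have "homog (0 + (card W + card (V - W))) (of_int (slog0 (ind E) W) * (epow (card W) * cpoly E (V - W)))"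
      using assms W by (intro homog_times homog_of_int homog_epow homog_cpoly) auto
    then show "homog (card V) (of_int (slog0 (ind E) W) * (epow (card W) * cpoly E (V - W)))"
      using W \<open>W \<in> _\<close> by simp
  qed
  show "epoly_eval esym ?F = csf E V"
    unfolding csf_rec[OF sym_E irrefl_E assms] using assms(1) W
    by (auto simp: epoly_eval_sum epoly_eval_epow epoly_eval_cpoly intro!: sum.cong)
qed (rule assms)

end

text \<open>The definite description in \<open>e_coeff\<close> is resolved here:
  \<open>cpoly\<close> supplies an expansion, and independence of the e_p makes it the only
  one.\<close>

lemma e_coeff_cpoly:
  assumes "pair_graph G" "p \<in> partitions_of (card (pverts G))"
  shows "e_coeff G p = Poly_Mapping.lookup (cpoly (parcs G) (pverts G)) (mset p)"
proof -
  let ?n = "card (pverts G)"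
  let ?F = "cpoly (parcs G) (pverts G)"
  let ?c = "\<lambda>p. if p \<in> partitions_of ?n then Poly_Mapping.lookup ?F (mset p) else 0"
  have G: "finite (pverts G)" "sym (parcs G)" "irrefl (parcs G)"
    using assms(1) by (auto simp: pair_graph_iff)
  have F: "chromatic_sf G = (\<Sum>p\<in>partitions_of ?n. of_int (?c p) * esym_partition p)"
    using epoly_eval_esym[OF homog_cpoly[OF G(2,3,1)]] epoly_eval_cpoly[OF G(2,3,1)]
    by (simp add: chromatic_sf_csf[OF assms(1)])
  have "e_coeff G = ?c"
    unfolding e_coeff_def
  proof (rule the_equality)
    show "is_e_expansion ?n (chromatic_sf G) ?c"
      unfolding is_e_expansion_def using F by auto
    fix c assume c: "is_e_expansion ?n (chromatic_sf G) c"
    have "(\<Sum>p\<in>partitions_of ?n. of_int (c p - ?c p) * esym_partition p) = 0"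
      using c F by (simp add: is_e_expansion_def left_diff_distrib sum_subtractf)
    then have "c p - ?c p = 0" if "p \<in> partitions_of ?n" for p
      using that by (rule esym_partitions_independent)
    then show "c = ?c"
      using c by (auto simp: is_e_expansion_def fun_eq_iff)
  qed
  then show ?thesis
    using assms(2) by simp
qed


section \<open>Hook coefficients\<close>

lemma coeff_minus_one_power_times:
  "coeff ((- 1) ^ t * P) i = (- 1) ^ t * coeff (P :: int poly) i"
  by (simp add: minus_one_power_iff)

lemma coeff_of_nat_times: "coeff (of_nat n * P) i = of_nat n * coeff (P :: int poly) i"
  by (simp add: of_nat_poly)

lemma coeff_of_int_times: "coeff (of_int n * P) i = n * coeff (P :: int poly) i"
  by (simp add: of_int_poly)

lemma coeff_times_0: "coeff (P * Q) 0 = coeff P 0 * coeff (Q :: int poly) 0"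
  by (simp add: coeff_mult)

lemma coeff_times_1: "coeff (P * Q) 1 = coeff P 0 * coeff Q 1 + coeff P 1 * coeff (Q :: int poly) 0"
  by (simp add: coeff_mult)

lemma coeff_epow_newton:
  fixes f :: "nat \<Rightarrow> int poly"
  shows "coeff (epoly_eval f (epow (Suc j))) i =
    (\<Sum>t<j. (- 1) ^ t * coeff (f (Suc t) * epoly_eval f (epow (j - t))) i) +
    (- 1) ^ j * (int (Suc j) * coeff (f (Suc j)) i)"
  unfolding epow_newton epoly_eval_add epoly_eval_sum epoly_eval_times epoly_eval_power
    epoly_eval_uminus epoly_eval_1 epoly_eval_egen epoly_eval_of_nat mult.assoc
    coeff_add coeff_sum coeff_minus_one_power_times coeff_of_nat_times ..

text \<open>
  Working modulo \<open>x\<^sup>2\<close>, the coefficients of \<open>1\<close> and \<open>x\<close> extract the coefficients of \<open>(1, \<dots>, 1)\<close> and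
  of the hook \<open>(k, 1, \<dots>, 1)\<close>.
\<close>

definition hook_eval :: "nat \<Rightarrow> nat \<Rightarrow> int poly" where
  "hook_eval k i = (if i = 1 then 1 else if i = k then [:0, 1:] else 0)"

lemma hook_eval_1: "hook_eval k (Suc 0) = 1"
  by (simp add: hook_eval_def)

lemma prod_hook_eval:
  assumes "k \<noteq> 1"
  shows "prod_mset (image_mset (hook_eval k) M) = (if set_mset M \<subseteq> {1, k} then [:0, 1:] ^ count M k else 0)"
  using assms by (induction M) (auto simp: hook_eval_def)

lemma coeff_X_power: "coeff ([:0, 1:] ^ n) i = (of_bool (n = i) :: int)"
  by (simp add: coeff_monom flip: monom_altdef[of 1, simplified])

lemma hook_multiset_iff:
  assumes "sum_mset M = n" "1 < (k :: nat)"
  shows "set_mset M \<subseteq> {1, k} \<and> count M k = 1 \<longleftrightarrow> M = add_mset k (replicate_mset (n - k) 1)"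
proof
  assume M: "set_mset M \<subseteq> {1, k} \<and> count M k = 1"
  then have "k \<in># M"
    by (simp flip: count_greater_zero_iff)
  then obtain N where N: "M = add_mset k N"
    by (metis multi_member_split)
  then have "count N k = 0"
    using M by simp
  then have "set_mset N \<subseteq> {1}"
    using M N by (auto simp: count_eq_zero_iff)
  then have "N = replicate_mset (size N) 1"
    by (metis set_mset_subset_singletonD)
  moreover have "sum_mset (replicate_mset (size N) 1) = size N"
    by (simp add: sum_mset_replicate_mset)
  ultimately have "n = k + size N"
    using assms(1) N by (metis sum_mset.add_mset)
  then show "M = add_mset k (replicate_mset (n - k) 1)"
    using N \<open>N = replicate_mset (size N) 1\<close> by simp
qed (use assms(2) in \<open>auto simp: in_replicate_mset\<close>)

lemma ones_multiset_iff:
  assumes "sum_mset M = n" "1 < (k :: nat)"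
  shows "set_mset M \<subseteq> {1, k} \<and> count M k = 0 \<longleftrightarrow> M = replicate_mset n 1"
proof
  assume "set_mset M \<subseteq> {1, k} \<and> count M k = 0"
  then have "set_mset M \<subseteq> {1}"
    by (auto simp: count_eq_zero_iff)
  then have M: "M = replicate_mset (size M) 1"
    by (metis set_mset_subset_singletonD)
  then have "sum_mset M = size M"
    by (metis mult.right_neutral of_nat_id sum_mset_replicate_mset)
  then show "M = replicate_mset n 1"
    using M assms(1) by simp
qed (use assms(2) in \<open>auto simp: in_replicate_mset\<close>)

lemma coeff_epoly_eval:
  fixes f :: "nat \<Rightarrow> int poly"
  assumes "homog n F"
    "\<And>M. sum_mset M = n \<Longrightarrow> 0 \<notin># M \<Longrightarrow> coeff (prod_mset (image_mset f M)) i = of_bool (M = N)"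
  shows "coeff (epoly_eval f F) i = Poly_Mapping.lookup F N"
proof -
  have "coeff (epoly_eval f F) i = (\<Sum>M\<in>Poly_Mapping.keys F. Poly_Mapping.lookup F M * of_bool (M = N))"
    unfolding epoly_eval_def coeff_sum coeff_of_int_times
    using assms by (intro sum.cong) (auto simp: homog_def)
  also have "\<dots> = (\<Sum>M\<in>Poly_Mapping.keys F. if M = N then Poly_Mapping.lookup F M else 0)"
    by (intro sum.cong) auto
  also have "\<dots> = Poly_Mapping.lookup F N"
    by (simp add: in_keys_iff)
  finally show ?thesis .
qed

text \<open>A monomial survives only if its parts are 1 or k, and becomes x to the number of its
  parts k; the degree n then fixes the number of ones.\<close>

lemma coeff_hook_eval:
  assumes "homog n F" "1 < k"
  shows coeff_0_hook_eval: "coeff (epoly_eval (hook_eval k) F) 0 = Poly_Mapping.lookup F (replicate_mset n 1)"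
    and coeff_1_hook_eval: "coeff (epoly_eval (hook_eval k) F) 1 =
      Poly_Mapping.lookup F (add_mset k (replicate_mset (n - k) 1))"
proof -
  show "coeff (epoly_eval (hook_eval k) F) 0 = Poly_Mapping.lookup F (replicate_mset n 1)"
  proof (rule coeff_epoly_eval[OF assms(1)])
    fix M assume "sum_mset M = n"
    note iff = ones_multiset_iff[OF this assms(2)]
    show "coeff (prod_mset (image_mset (hook_eval k) M)) 0 = of_bool (M = replicate_mset n 1)"
      unfolding iff[symmetric]
      using assms(2) by (simp add: prod_hook_eval coeff_X_power)
  qed
  show "coeff (epoly_eval (hook_eval k) F) 1 = Poly_Mapping.lookup F (add_mset k (replicate_mset (n - k) 1))"
  proof (rule coeff_epoly_eval[OF assms(1)])
    fix M assume "sum_mset M = n"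
    note iff = hook_multiset_iff[OF this assms(2)]
    show "coeff (prod_mset (image_mset (hook_eval k) M)) 1 = of_bool (M = add_mset k (replicate_mset (n - k) 1))"
      unfolding iff[symmetric]
      using assms(2) by (simp add: prod_hook_eval coeff_X_power)
  qed
qed

text \<open>At x = 0 this is the specialisation to one variable equal to 1, under which every p_n is
  1.\<close>

lemma coeff_0_hook_epow:
  assumes "1 < k" "0 < n"
  shows "coeff (epoly_eval (hook_eval k) (epow n)) 0 = 1"
  using assms(2)
proof (induction n rule: nat_induct_non_zero)
  case 1
  then show ?case
    using coeff_epow_newton[of "hook_eval k" 0 0] by (simp add: hook_eval_1)
next
  case (Suc j)
  have "(\<Sum>t<j. (- 1) ^ t * coeff (hook_eval k (Suc t) * epoly_eval (hook_eval k) (epow (j - t))) 0) =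
      (\<Sum>t<j. if t = 0 then coeff (epoly_eval (hook_eval k) (epow j)) 0 else 0)"
    by (intro sum.cong) (auto simp: coeff_times_0 hook_eval_def)
  then show ?case
    using Suc assms(1) unfolding coeff_epow_newton by (simp add: hook_eval_def)
qed

text \<open>In Newton's identity e_k first enters at n = k through the last term, with value
  (-1)^(k+1) k. Every later step keeps the previous value through e_1 p_(n-1) and adds (-1)^(k+1)
  through e_k p_(n-k), as p_(n-k) has constant coefficient 1.\<close>

lemma coeff_1_hook_epow:
  assumes "1 < k" "0 < n"
  shows "coeff (epoly_eval (hook_eval k) (epow n)) 1 = (- 1) ^ (k + 1) * of_bool (k \<le> n) * int n"
  using assms(2)
proof (induction n rule: nat_induct_non_zero)
  case 1
  then show ?case
    using coeff_epow_newton[of "hook_eval k" 0 1] assms(1) by (simp add: hook_eval_1)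
next
  case (Suc j)
  let ?e = "epoly_eval (hook_eval k)"
  have "(\<Sum>t<j. (- 1) ^ t * coeff (hook_eval k (Suc t) * ?e (epow (j - t))) 1) =
      (\<Sum>t<j. (if t = 0 then coeff (?e (epow j)) 1 else 0) + (if t = k - 1 then (- 1) ^ (k - 1) else 0))"
  proof (rule sum.cong[OF refl])
    fix t assume "t \<in> {..<j}"
    then have "coeff (?e (epow (j - t))) 0 = 1"
      using assms(1) by (intro coeff_0_hook_epow) auto
    then show "(- 1) ^ t * coeff (hook_eval k (Suc t) * ?e (epow (j - t))) 1 =
        (if t = 0 then coeff (?e (epow j)) 1 else 0) + (if t = k - 1 then (- 1) ^ (k - 1) else 0)"
      using assms(1) unfolding coeff_times_1 by (auto simp: hook_eval_def)
  qed
  also have "\<dots> = coeff (?e (epow j)) 1 + (if k \<le> j then (- 1) ^ (k - 1) else 0)"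
    using Suc.hyps assms(1) by (auto simp: sum.distrib)
  also have "(- 1 :: int) ^ (k - 1) = (- 1) ^ (k + 1)"
    using assms(1) by (simp add: minus_one_power_iff)
  also have "(- 1) ^ j * (int (Suc j) * coeff (hook_eval k (Suc j)) 1) =
      (if Suc j = k then (- 1) ^ (k + 1) * int (Suc j) else 0)"
    using Suc.hyps by (auto simp: hook_eval_def)
  note last = this
  show ?case
    unfolding coeff_epow_newton last calculation Suc.IH by (auto simp: algebra_simps)
qed

section \<open>Hook coefficients of chromatic symmetric functions\<close>

context
  fixes E :: "('v \<times> 'v) set"
  assumes sym_E: "sym E" and irrefl_E: "irrefl E"
begin

text \<open>In one variable only the constant colouring is left, which is proper iff there are no
  edges. Formally, all power sums become 1 and the recursion turns into
  \<open>slog0_rec\<close>.\<close>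

lemma coeff_0_hook_cpoly:
  assumes "1 < k" "finite V"
  shows "coeff (epoly_eval (hook_eval k) (cpoly E V)) 0 = ind E V"
  using assms(2)
proof (induction V rule: finite_psubset_induct)
  case (psubset V)
  show ?case
  proof (cases "V = {}")
    case True
    then show ?thesis
      by (simp add: cpoly_empty[OF sym_E irrefl_E])
  next
    case False
    then obtain v where v: "v \<in> V"
      by auto
    have "coeff (epoly_eval (hook_eval k) (cpoly E V)) 0 =
        (\<Sum>W | v \<in> W \<and> W \<subseteq> V. slog0 (ind E) W * ind E (V - W))"
      unfolding cpoly_rec[OF sym_E irrefl_E psubset.hyps v] epoly_eval_sum coeff_sum
        epoly_eval_times epoly_eval_of_int coeff_of_int_times
      unfolding coeff_times_0
    proof (rule sum.cong[OF refl])
      fix W assume W: "W \<in> {W. v \<in> W \<and> W \<subseteq> V}"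
      then have "0 < card W" "V - W \<subset> V"
        using psubset.hyps finite_subset[of W V] by (auto simp: card_gt_0_iff)
      then show "slog0 (ind E) W * (coeff (epoly_eval (hook_eval k) (epow (card W))) 0 *
          coeff (epoly_eval (hook_eval k) (cpoly E (V - W))) 0) = slog0 (ind E) W * ind E (V - W)"
        using assms(1) by (simp add: coeff_0_hook_epow psubset.IH)
    qed
    also have "\<dots> = ind E V"
      using psubset.hyps v by (intro slog0_rec[symmetric]) auto
    finally show ?thesis .
  qed
qed

text \<open>The Leibniz rule applied to \<open>cpoly_rec\<close> is the recursion of
  \<open>slog0_derivation\<close>, with h(W) the coefficient of x in the image of p_|W|.\<close>

lemma coeff_1_hook_cpoly:
  assumes "1 < k" "finite V"
  shows "coeff (epoly_eval (hook_eval k) (cpoly E V)) 1 = (\<Sum>W\<in>Pow V - {{}}.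
    slog0 (ind E) W * ((- 1) ^ (k + 1) * of_bool (k \<le> card W) * int (card W)) * ind E (V - W))"
  using assms(2)
proof (induction V rule: finite_psubset_induct)
  case (psubset V)
  let ?h = "\<lambda>W. (- 1) ^ (k + 1) * of_bool (k \<le> card W) * int (card W)"
  let ?G = "\<lambda>V. \<Sum>W\<in>Pow V - {{}}. slog0 (ind E) W * ?h W * ind E (V - W)"
  show ?case
  proof (cases "V = {}")
    case True
    then show ?thesis
      by (simp add: cpoly_empty[OF sym_E irrefl_E])
  next
    case False
    then obtain v where v: "v \<in> V"
      by auto
    have "coeff (epoly_eval (hook_eval k) (cpoly E V)) 1 =
        (\<Sum>W | v \<in> W \<and> W \<subseteq> V. slog0 (ind E) W * (?h W * ind E (V - W) + ?G (V - W)))"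
      unfolding cpoly_rec[OF sym_E irrefl_E psubset.hyps v] epoly_eval_sum coeff_sum
        epoly_eval_times epoly_eval_of_int coeff_of_int_times
      unfolding coeff_times_1
    proof (rule sum.cong[OF refl])
      fix W assume W: "W \<in> {W. v \<in> W \<and> W \<subseteq> V}"
      then have pos: "0 < card W" and sub: "V - W \<subset> V"
        using psubset.hyps finite_subset[of W V] by (auto simp: card_gt_0_iff)
      have fin: "finite (V - W)"
        using psubset.hyps by simp
      show "slog0 (ind E) W *
          (coeff (epoly_eval (hook_eval k) (epow (card W))) 0 * coeff (epoly_eval (hook_eval k) (cpoly E (V - W))) 1 +
           coeff (epoly_eval (hook_eval k) (epow (card W))) 1 * coeff (epoly_eval (hook_eval k) (cpoly E (V - W))) 0) =
          slog0 (ind E) W * (?h W * ind E (V - W) + ?G (V - W))"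
        unfolding coeff_0_hook_epow[OF assms(1) pos] coeff_1_hook_epow[OF assms(1) pos]
          psubset.IH[OF sub] coeff_0_hook_cpoly[OF assms(1) fin] by (simp only: mult_1 add.commute)
    qed
    also have "\<dots> = ?G V"
      using psubset.hyps v by (intro slog0_derivation[symmetric]) auto
    finally show ?thesis .
  qed
qed

text \<open>The factor \<open>card W\<close> is spent on choosing a root v in W; after exchanging
  the sums, each v contributes a non-negative tail.\<close>

lemma hook_coeff_nonneg:
  assumes "1 < k" "finite V" "k \<le> card V"
  shows "0 \<le> coeff (epoly_eval (hook_eval k) (cpoly E V)) 1"
proof -
  let ?c = "\<lambda>W. (- 1) ^ (k + 1) * of_bool (k \<le> card W) :: int"
  have "coeff (epoly_eval (hook_eval k) (cpoly E V)) 1 =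
      (\<Sum>W\<in>Pow V - {{}}. slog0 (ind E) W * (?c W * int (card W)) * ind E (V - W))"
    by (rule coeff_1_hook_cpoly[OF assms(1,2)])
  also have "\<dots> = (\<Sum>W\<in>Pow V. \<Sum>v\<in>{v \<in> V. v \<in> W}. slog (ind E) v W * ?c W * ind E (V - W))"
  proof (rule sum.mono_neutral_cong_left)
    fix W assume W: "W \<in> Pow V - {{}}"
    have eq: "{v \<in> V. v \<in> W} = W"
      using W by auto
    have "slog (ind E) v W = slog0 (ind E) W" if "v \<in> W" for v
      using that W assms(2) by (intro slog0_eq[symmetric]) (auto intro: finite_subset)
    then show "slog0 (ind E) W * (?c W * int (card W)) * ind E (V - W) =
        (\<Sum>v\<in>{v \<in> V. v \<in> W}. slog (ind E) v W * ?c W * ind E (V - W))"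
      unfolding eq by simp
  qed (use assms(2) in auto)
  also have "\<dots> = (\<Sum>v\<in>V. \<Sum>W\<in>{W \<in> Pow V. v \<in> W}. slog (ind E) v W * ?c W * ind E (V - W))"
    using assms(2) by (intro sum.swap_restrict) auto
  also have "\<dots> \<ge> 0"
  proof (rule sum_nonneg)
    fix v assume "v \<in> V"
    moreover have "{W \<in> Pow V. v \<in> W} = {W. v \<in> W \<and> W \<subseteq> V}"
      by auto
    ultimately show "0 \<le> (\<Sum>W\<in>{W \<in> Pow V. v \<in> W}. slog (ind E) v W * ?c W * ind E (V - W))"
      using slog_tail_nonneg[OF sym_E irrefl_E assms(2), of v k] assms(1,3) by simp
  qed
  finally show ?thesis .
qed

end

lemma hook_e_positive:
  assumes "is_partition p" "is_hook p"
  shows "e_positive p"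
  unfolding e_positive_def
proof (intro allI impI)
  fix G :: "nat pair_pre_digraph"
  assume G: "pair_graph G \<and> card (pverts G) = sum_list p"
  let ?n = "sum_list p"
  let ?F = "cpoly (parcs G) (pverts G)"
  have E: "sym (parcs G)" "irrefl (parcs G)" and fin: "finite (pverts G)"
    using G by (auto simp: pair_graph_iff)
  have hom: "homog ?n ?F"
    using homog_cpoly[OF E fin] G by simp
  obtain l where small: "mset (filter (\<lambda>k. \<not> 1 < k) p) = replicate_mset l 1"
  proof
    have "set_mset (mset (filter (\<lambda>k. \<not> 1 < k) p)) \<subseteq> {1}"
      using assms(1) by (fastforce simp: is_partition_def)
    then show "mset (filter (\<lambda>k. \<not> 1 < k) p) = replicate_mset (length (filter (\<lambda>k. \<not> 1 < k) p)) 1"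
      by (metis set_mset_subset_singletonD size_mset)
  qed
  have p: "mset p = mset (filter (\<lambda>k. 1 < k) p) + mset (filter (\<lambda>k. \<not> 1 < k) p)"
    by (simp only: mset_filter multiset_partition[symmetric])
  have sum: "?n = sum_mset (mset p)"
    by (simp add: sum_mset_sum_list)
  have "0 \<le> Poly_Mapping.lookup ?F (mset p)"
  proof (cases "filter (\<lambda>k. 1 < k) p")
    case Nil
    then have l: "mset p = replicate_mset l 1"
      unfolding p small by simp
    then have "?n = l"
      using sum by (simp add: sum_mset_replicate_mset)
    \<comment> \<open>The constant coefficient is the same for every k > 1; 2 is an arbitrary
      choice.\<close>
    then show ?thesis
      using l coeff_0_hook_eval[OF hom, of 2] coeff_0_hook_cpoly[OF E _ fin, of 2] ind_nonneg[of "parcs G" "pverts G"]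
      by (simp del: ind_nonneg)
  next
    case (Cons k q)
    then have "q = []"
      using assms(2) by (simp add: is_hook_def)
    then have l: "mset p = add_mset k (replicate_mset l 1)"
      unfolding p small Cons by simp
    then have n: "?n = k + l"
      using sum by (simp add: sum_mset_replicate_mset)
    have "k \<in> set (filter (\<lambda>k. 1 < k) p)"
      using Cons by simp
    then have "1 < k"
      by simp
    then show ?thesis
      using l n G coeff_1_hook_eval[OF hom, of k] hook_coeff_nonneg[OF E _ fin, of k] by simp
  qed
  then show "0 \<le> e_coeff G p"
    using e_coeff_cpoly[of G p] G assms(1) by (simp add: partitions_of_def)
qed


section \<open>Stars\<close>

text \<open>The power of x counts factors. In degree a + b, two factors from e_a and e_b can only be
  e_a e_b, even if a = b.\<close>

definition pair_eval :: "nat \<Rightarrow> nat \<Rightarrow> nat \<Rightarrow> int poly" where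
  "pair_eval a b i = (if i = a \<or> i = b then [:0, 1:] else 0)"

lemma prod_pair_eval:
  "prod_mset (image_mset (pair_eval a b) M) = (if set_mset M \<subseteq> {a, b} then [:0, 1:] ^ size M else 0)"
  by (induction M) (auto simp: pair_eval_def)

lemma coeff_2_pair_eval:
  assumes "homog (a + b) F"
  shows "coeff (epoly_eval (pair_eval a b) F) 2 = Poly_Mapping.lookup F {#a, b#}"
proof (rule coeff_epoly_eval[OF assms])
  fix M :: "nat multiset" assume M: "sum_mset M = a + b" "0 \<notin># M"
  have "M = {#a, b#}" if size: "size M = 2" and sub: "set_mset M \<subseteq> {a, b}"
  proof -
    obtain x N where N: "M = add_mset x N"
      using size size_eq_Suc_imp_eq_union[of M 1] by auto
    then obtain y where "N = {#y#}"
      using size size_1_singleton_mset[of N] by auto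
    with N have "M = {#x, y#}"
      by simp
    then show ?thesis
      using M sub by auto
  qed
  then have iff: "set_mset M \<subseteq> {a, b} \<and> size M = 2 \<longleftrightarrow> M = {#a, b#}"
    by (intro iffI) (blast, simp)
  show "coeff (prod_mset (image_mset (pair_eval a b) M)) 2 = of_bool (M = {#a, b#})"
    unfolding iff[symmetric] by (simp add: prod_pair_eval coeff_X_power)
qed

definition star :: "nat \<Rightarrow> (nat \<times> nat) set" where
  "star n = {(x, y). x < n \<and> y < n \<and> (x = 0) \<noteq> (y = 0)}"

lemma star_graph: "sym (star n)" "irrefl (star n)" "star n \<subseteq> {..<n} \<times> {..<n}"
  by (auto simp: star_def sym_def irrefl_def)

lemma ind_star_leaves: "0 \<notin> W \<Longrightarrow> ind (star n) W = 1"
  by (auto simp: ind_def star_def)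

text \<open>Up to sign: exactly one acyclic orientation has the centre as its only sink. The
  proposed signs satisfy the recursion because their sum over all U containing 0 vanishes unless W =
  {0}, just as \<open>ind\<close> does.\<close>

lemma slog_star:
  assumes "finite W" "0 \<in> W" "W \<subseteq> {..<n}"
  shows "slog (ind (star n)) 0 W = (- 1) ^ (card W + 1)"
  using assms
proof (induction W rule: finite_psubset_induct)
  case (psubset W)
  let ?s = "\<lambda>U. (- 1) ^ (card U + 1) :: int"
  have fin: "finite {U. 0 \<in> U \<and> U \<subset> W}"
    using psubset.hyps by (auto intro: finite_subset[of _ "Pow W"])
  have "(\<Sum>U | 0 \<in> U \<and> U \<subseteq> W. ?s U) = (\<Sum>K\<in>Pow (W - {0}). (- 1) ^ card K)"
  proof (rule sum.reindex_bij_witness[where i = "insert 0" and j = "\<lambda>U. U - {0}"])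
    fix U assume U: "U \<in> {U. 0 \<in> U \<and> U \<subseteq> W}"
    then have "card U = Suc (card (U - {0}))"
      using psubset.hyps finite_subset[of U W] by (intro card.remove) auto
    then show "(- 1) ^ card (U - {0}) = ?s U"
      by simp
  qed (use psubset.prems in auto)
  also have "\<dots> = of_bool (W = {0})"
    using psubset sum_Pow_alternating[of "W - {0}"] by auto
  also have "\<dots> = ind (star n) W"
  proof (cases "W = {0}")
    case False
    then obtain x where "x \<in> W" "x \<noteq> 0"
      using psubset.prems by auto
    then have "(0, x) \<in> star n"
      using psubset.prems by (auto simp: star_def)
    then show ?thesis
      using False psubset.prems \<open>x \<in> W\<close> by (auto simp: ind_def)
  qed (simp add: ind_singleton star_graph)
  also have "{U. 0 \<in> U \<and> U \<subseteq> W} = insert W {U. 0 \<in> U \<and> U \<subset> W}"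
    using psubset.prems by auto
  finally have "ind (star n) W = ?s W + (\<Sum>U | 0 \<in> U \<and> U \<subset> W. ?s U)"
    using fin by simp
  moreover have "(\<Sum>U | 0 \<in> U \<and> U \<subset> W. slog (ind (star n)) 0 U * ind (star n) (W - U)) =
      (\<Sum>U | 0 \<in> U \<and> U \<subset> W. ?s U)"
    using psubset by (intro sum.cong) (auto simp: ind_star_leaves)
  ultimately show ?case
    using psubset.hyps by (simp add: slog.simps[of _ 0 W])
qed

section \<open>The coefficient of e_a e_b in power sums and in stars\<close>

context
  fixes a b :: nat
  assumes a: "1 < a" and b: "1 < b"
begin

lemma coeff_pair_eval_times:
  "coeff (pair_eval a b i * P) 0 = 0"
  "coeff (pair_eval a b i * P) (Suc j) = of_bool (i \<in> {a, b}) * coeff P j"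
  by (simp_all add: pair_eval_def)

lemma coeff_0_pair_epow: "0 < n \<Longrightarrow> coeff (epoly_eval (pair_eval a b) (epow n)) 0 = 0"
  using coeff_epow_newton[of "pair_eval a b" "n - 1" 0]
  by (simp add: coeff_pair_eval_times) (simp add: pair_eval_def)

text \<open>The products in Newton's identity start at x^2, so only its last term
  contributes.\<close>

lemma coeff_1_pair_epow:
  assumes "0 < n"
  shows "coeff (epoly_eval (pair_eval a b) (epow n)) 1 = (- 1) ^ (n + 1) * int n * of_bool (n \<in> {a, b})"
proof -
  obtain j where n: "n = Suc j"
    using assms by (cases n) auto
  have "(\<Sum>t<j. (- 1) ^ t * coeff (pair_eval a b (Suc t) * epoly_eval (pair_eval a b) (epow (j - t))) 1) = 0"
    using coeff_0_pair_epow unfolding One_nat_def coeff_pair_eval_times by (intro sum.neutral) simp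
  then show ?thesis
    unfolding n coeff_epow_newton by (simp add: pair_eval_def)
qed

text \<open>All contributions, e_a p_b and e_b p_a in Newton's identity, carry the sign (-1)^(a+b),
  so nothing cancels.\<close>

lemma coeff_2_pair_epow_sign: "0 < (- 1) ^ (a + b) * coeff (epoly_eval (pair_eval a b) (epow (a + b))) 2"
proof -
  let ?e = "epoly_eval (pair_eval a b)"
  obtain j where j: "a + b = Suc j"
    using a by (cases "a + b") auto
  let ?g = "\<lambda>t. int (j - t) * of_bool (Suc t \<in> {a, b} \<and> j - t \<in> {a, b})"
  have "coeff (?e (epow (a + b))) 2 =
      (\<Sum>t<j. (- 1) ^ t * (of_bool (Suc t \<in> {a, b}) * coeff (?e (epow (j - t))) 1))"
    unfolding j coeff_epow_newton numeral_2_eq_2 coeff_pair_eval_times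
    by (simp add: pair_eval_def)
  also have "\<dots> = (\<Sum>t<j. (- 1) ^ (a + b) * ?g t)"
  proof (rule sum.cong[OF refl])
    fix t assume t: "t \<in> {..<j}"
    then have coeff_1: "coeff (?e (epow (j - t))) 1 = (- 1) ^ (j - t + 1) * int (j - t) * of_bool (j - t \<in> {a, b})"
      by (intro coeff_1_pair_epow) auto
    have sign: "(- 1) ^ t * (- 1) ^ (j - t + 1) = (- 1 :: int) ^ (a + b)"
      using t j by (simp flip: power_add)
    show "(- 1) ^ t * (of_bool (Suc t \<in> {a, b}) * coeff (?e (epow (j - t))) 1) =
        (- 1) ^ (a + b) * ?g t"
      unfolding of_bool_conj coeff_1 sign[symmetric] by (simp only: mult_ac)
  qed
  finally have "(- 1) ^ (a + b) * coeff (?e (epow (a + b))) 2 = (\<Sum>t<j. ?g t)"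
    by (simp add: sum_distrib_left[symmetric] flip: mult.assoc power_add)
  moreover have "0 < (\<Sum>t<j. ?g t)"
  \<comment> \<open>Index t belongs to e_(t+1), so t = a - 1 is the term e_a p_b.\<close>
  proof (rule sum_pos2[of _ "a - 1"])
    show "a - 1 \<in> {..<j}"
      using a b j by auto
    have "j - (a - 1) = b"
      using a j by linarith
    then show "0 < ?g (a - 1)"
      using a b by simp
  qed auto
  ultimately show ?thesis
    by simp
qed

text \<open>An edgeless graph has X = e_1^|U|, and e_1 is sent to 0 because a, b > 1.\<close>

lemma epoly_eval_edgeless:
  assumes "sym E" "irrefl E" "finite U" "v \<in> U" "\<And>x y. x \<in> U \<Longrightarrow> y \<in> U \<Longrightarrow> (x, y) \<notin> E"
  shows "epoly_eval (pair_eval a b) (cpoly E U) = 0"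
  unfolding cpoly_rec[OF assms(1-4)] epoly_eval_sum
proof (rule sum.neutral, rule ballI)
  fix W assume W: "W \<in> {W. v \<in> W \<and> W \<subseteq> U}"
  show "epoly_eval (pair_eval a b) (of_int (slog0 (ind E) W) * (epow (card W) * cpoly E (U - W))) = 0"
  proof (cases "W = {v}")
    case True
    have "epow 1 = egen 1"
      using epow_newton[of 0] by simp
    then show ?thesis
      using True a b by (simp add: pair_eval_def)
  next
    case False
    then obtain x where x: "x \<in> W" "x \<noteq> v"
      using W by auto
    have "finite W"
      using W assms(3) finite_subset by auto
    then have "slog (ind E) v W = 0"
      using x W assms(5) by (intro slog_isolated[OF assms(1,2), of _ x]) (auto simp: isolated_def)
    then show ?thesis
      using slog0_eq[of W v "ind E"] W \<open>finite W\<close> by simp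
  qed
qed

text \<open>Root the recursion at the centre. If W omits a leaf, the rest is nonempty and edgeless
  and evaluates to 0. Only W = V remains, where the sign (-1)^(a+b+1) of the logarithm is opposite
  to that of p_(a+b).\<close>

lemma star_coeff_negative: "Poly_Mapping.lookup (cpoly (star (a + b)) {..<a + b}) {#a, b#} < 0"
proof -
  let ?n = "a + b"
  let ?V = "{..<?n}"
  let ?E = "star ?n"
  let ?e = "epoly_eval (pair_eval a b)"
  have V: "0 \<in> ?V" "finite ?V"
    using a by auto
  have "?e (cpoly ?E ?V) = (\<Sum>W | 0 \<in> W \<and> W \<subseteq> ?V.
      ?e (of_int (slog0 (ind ?E) W) * (epow (card W) * cpoly ?E (?V - W))))"
    unfolding cpoly_rec[OF star_graph(1,2) V(2,1)] by (rule epoly_eval_sum)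
  also have "\<dots> = (\<Sum>W\<in>{?V}. ?e (of_int (slog0 (ind ?E) W) * (epow (card W) * cpoly ?E (?V - W))))"
  proof (rule sum.mono_neutral_right)
    show "finite {W. 0 \<in> W \<and> W \<subseteq> ?V}"
      by (auto intro: finite_subset[of _ "Pow ?V"])
    show "\<forall>W\<in>{W. 0 \<in> W \<and> W \<subseteq> ?V} - {?V}.
        ?e (of_int (slog0 (ind ?E) W) * (epow (card W) * cpoly ?E (?V - W))) = 0"
    proof
      fix W assume W: "W \<in> {W. 0 \<in> W \<and> W \<subseteq> ?V} - {?V}"
      then obtain v where "v \<in> ?V - W"
        by auto
      then have "?e (cpoly ?E (?V - W)) = 0"
        using W by (intro epoly_eval_edgeless[OF star_graph(1,2)]) (auto simp: star_def)
      then show "?e (of_int (slog0 (ind ?E) W) * (epow (card W) * cpoly ?E (?V - W))) = 0"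
        by simp
    qed
  qed (use V in auto)
  also have "\<dots> = of_int (slog0 (ind ?E) ?V) * ?e (epow ?n)"
    by (simp add: cpoly_empty[OF star_graph(1,2)])
  also have "slog0 (ind ?E) ?V = (- 1) ^ (?n + 1)"
    using slog0_eq[OF V(2,1), of "ind ?E"] slog_star[OF V(2,1)] by simp
  finally have "coeff (?e (cpoly ?E ?V)) 2 = - ((- 1) ^ ?n * coeff (?e (epow ?n)) 2)"
    by (simp add: coeff_minus_one_power_times)
  also have "\<dots> < 0"
    using coeff_2_pair_epow_sign by simp
  finally show ?thesis
    using coeff_2_pair_eval[of a b "cpoly ?E ?V"] homog_cpoly[OF star_graph(1,2) V(2), of ?n] by simp
qed

end


section \<open>Disjoint unions with cliques\<close>

text \<open>Proper colourings of a clique are the injective ones, and each possible image is reached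
  by (card A)! of them.\<close>

lemma csf_clique:
  assumes "finite A" "\<And>x y. x \<in> A \<Longrightarrow> y \<in> A \<Longrightarrow> (x, y) \<in> E \<longleftrightarrow> x \<noteq> y"
  shows "csf E A = of_nat (fact (card A)) * esym (card A)"
proof (rule mfps_eqI)
  fix m
  let ?C = "\<lambda>S. {\<chi> \<in> A \<rightarrow>\<^sub>E S. inj_on \<chi> A}"
  let ?S = "{S \<in> {S. finite S \<and> card S = card A}. set_monomial S = m}"
  have image: "\<chi> ` A = S" if "S \<in> ?S" "\<chi> \<in> ?C S" for \<chi> S
    using that by (intro card_subset_eq) (auto simp: card_image)
  have mon: "colour_monomial A \<chi> = set_monomial (\<chi> ` A)" if "inj_on \<chi> A" for \<chi>
    using that by (simp add: sum.reindex)
  have col: "colourings E A = {\<chi> \<in> A \<rightarrow>\<^sub>E UNIV. inj_on \<chi> A}"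
    using assms(2) unfolding colourings_def inj_on_def by (intro Collect_cong) blast
  have "{\<chi> \<in> colourings E A. colour_monomial A \<chi> = m} = (\<Union>S\<in>?S. ?C S)"
  proof (intro equalityI subsetI)
    fix \<chi> assume \<chi>: "\<chi> \<in> {\<chi> \<in> colourings E A. colour_monomial A \<chi> = m}"
    then have "\<chi> ` A \<in> ?S" "\<chi> \<in> ?C (\<chi> ` A)"
      using assms(1) mon[of \<chi>] unfolding col by (auto simp: card_image PiE_def)
    then show "\<chi> \<in> (\<Union>S\<in>?S. ?C S)"
      by blast
  next
    fix \<chi> assume "\<chi> \<in> (\<Union>S\<in>?S. ?C S)"
    then obtain S where S: "S \<in> ?S" "\<chi> \<in> ?C S"
      by blast
    then show "\<chi> \<in> {\<chi> \<in> colourings E A. colour_monomial A \<chi> = m}"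
      using image[OF S] mon[of \<chi>] unfolding col by (auto simp: PiE_def)
  qed
  moreover have "card (\<Union>S\<in>?S. ?C S) = (\<Sum>S\<in>?S. card (?C S))"
  proof (rule card_UN_disjoint[of ?S ?C]; (intro ballI impI)?)
    show "finite ?S"
      by (rule finite_sets_with_monomial)
    show "finite (?C S)" if "S \<in> ?S" for S
    proof (rule finite_subset)
      show "finite (A \<rightarrow>\<^sub>E S)"
        using that assms(1) by (intro finite_PiE) auto
    qed blast
    show "?C S \<inter> ?C S' = {}" if "S \<in> ?S" "S' \<in> ?S" "S \<noteq> S'" for S S'
    proof (rule Int_emptyI)
      fix \<chi> assume "\<chi> \<in> ?C S" "\<chi> \<in> ?C S'"
      then show False
        using image[OF that(1)] image[OF that(2)] that(3) by metis
    qed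
  qed
  moreover have "(\<Sum>S\<in>?S. card (?C S)) = (\<Sum>S\<in>?S. fact (card A))"
  proof (rule sum.cong[OF refl])
    fix S assume "S \<in> ?S"
    then show "card (?C S) = fact (card A)"
      using card_inj_on_subset_funcset[of A S A] assms(1) by (simp add: fact_prod_rev)
  qed
  ultimately have "int (card {\<chi> \<in> colourings E A. colour_monomial A \<chi> = m}) = of_nat (fact (card A)) * int (card ?S)"
    by (simp only: sum_constant of_nat_mult of_nat_id mult.commute)
  then show "mfps_nth (csf E A) m = mfps_nth (of_nat (fact (card A)) * esym (card A)) m"
    unfolding csf_def esym_def mfps_nth_of_nat_times mfps_nth_monomial_series .
qed

lemma csf_cong:
  "(\<And>x y. x \<in> V \<Longrightarrow> y \<in> V \<Longrightarrow> (x, y) \<in> E \<longleftrightarrow> (x, y) \<in> E') \<Longrightarrow> csf E V = csf E' V"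
  unfolding csf_def colourings_def by (intro arg_cong2[of _ _ _ _ monomial_series] Collect_cong) auto

lemma lookup_times_egen:
  "Poly_Mapping.lookup (F * (of_nat c * egen k)) (add_mset k M) = int c * Poly_Mapping.lookup F M"
proof -
  have "(of_nat c * egen k :: epoly) = Poly_Mapping.single {#k#} (int c)"
    by (simp add: egen_def mult_single flip: single_of_nat)
  moreover have "Poly_Mapping.keys F \<subseteq> UNIV"
    by simp
  then have "Poly_Mapping.lookup (F * Poly_Mapping.single {#k#} (int c)) (add_mset k M) = int c * Poly_Mapping.lookup F M"
  proof (induction F rule: frag_induction)
    case (one N)
    then show ?case
      by (auto simp: mult_single lookup_single when_def)
  qed (simp_all add: left_diff_distrib right_diff_distrib lookup_minus)
  ultimately show ?thesis
    by simp
qed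

text \<open>Each further part k adds a clique on a fresh block of k vertices, an isolated vertex if
  k = 1. Its factor k! e_k carries the negative coefficient over to the enlarged partition.\<close>

lemma negative_graph_exists:
  assumes "1 < a" "1 < b" "\<forall>k\<in>set q. 0 < k"
  shows "\<exists>(E :: (nat \<times> nat) set) n. sym E \<and> irrefl E \<and> E \<subseteq> {..<n} \<times> {..<n} \<and> n = a + b + sum_list q \<and>
    Poly_Mapping.lookup (cpoly E {..<n}) ({#a, b#} + mset q) < 0"
  using assms(3)
proof (induction q)
  case Nil
  show ?case
    using star_graph star_coeff_negative[OF assms(1,2)]
    by (intro exI[of _ "star (a + b)"] exI[of _ "a + b"]) simp
next
  case (Cons k q)
  then obtain E n where E: "sym E" "irrefl E" "E \<subseteq> {..<n} \<times> {..<n}" and n: "n = a + b + sum_list q"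
    and neg: "Poly_Mapping.lookup (cpoly E {..<n}) ({#a, b#} + mset q) < 0"
    by auto
  let ?A = "{n..<n + k}"
  let ?E = "E \<union> {(x, y). x \<in> ?A \<and> y \<in> ?A \<and> x \<noteq> y}"
  have E': "sym ?E" "irrefl ?E" "?E \<subseteq> {..<n + k} \<times> {..<n + k}"
    using E by (auto simp: sym_def irrefl_def)
  have V: "{..<n + k} = {..<n} \<union> ?A"
    by auto
  have "csf ?E {..<n + k} = csf ?E {..<n} * csf ?E ?A"
    unfolding V using E E'(1) by (intro csf_Un) auto
  also have "csf ?E {..<n} = csf E {..<n}"
    by (intro csf_cong) auto
  also have "csf ?E ?A = of_nat (fact k) * esym k"
    using E csf_clique[of ?A ?E] by fastforce
  finally have csf: "csf ?E {..<n + k} = csf E {..<n} * (of_nat (fact k) * esym k)" .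
  have "cpoly ?E {..<n + k} = cpoly E {..<n} * (of_nat (fact k) * egen k)"
  proof (rule cpoly_eqI[OF E'(1,2)])
    have "homog (n + (0 + k)) (cpoly E {..<n} * (of_nat (fact k) * egen k))"
      using Cons.prems homog_cpoly[OF E(1,2), of "{..<n}"]
      by (intro homog_times homog_of_nat homog_egen) auto
    then show "homog (card {..<n + k}) (cpoly E {..<n} * (of_nat (fact k) * egen k))"
      by simp
    show "epoly_eval esym (cpoly E {..<n} * (of_nat (fact k) * egen k)) = csf ?E {..<n + k}"
      unfolding csf by (simp add: epoly_eval_cpoly[OF E(1,2)] del: of_nat_fact)
  qed simp
  then have "Poly_Mapping.lookup (cpoly ?E {..<n + k}) ({#a, b#} + mset (k # q)) =
      int (fact k) * Poly_Mapping.lookup (cpoly E {..<n}) ({#a, b#} + mset q)"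
    using lookup_times_egen[of "cpoly E {..<n}" "fact k" k "{#a, b#} + mset q"] by (simp add: add_mset_commute)
  also have "\<dots> < 0"
    using neg by (simp add: mult_less_0_iff)
  finally show ?case
    using E' n by (intro exI[of _ ?E] exI[of _ "n + k"]) simp
qed

lemma not_hook_not_e_positive:
  assumes "is_partition p" "\<not> is_hook p"
  shows "\<not> e_positive p"
proof -
  obtain a b r where r: "filter (\<lambda>k. 1 < k) p = a # b # r"
    using assms(2) unfolding is_hook_def
    \<comment> \<open>The rule serves as a three-way split into empty, singleton and longer
      lists.\<close>
    by (cases "filter (\<lambda>k. 1 < k) p" rule: remdups_adj.cases) auto
  let ?q = "r @ filter (\<lambda>k. \<not> 1 < k) p"
  have p: "mset p = {#a, b#} + mset ?q"
  proof -
    have "mset p = mset (filter (\<lambda>k. 1 < k) p) + mset (filter (\<lambda>k. \<not> 1 < k) p)"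
      by (simp only: mset_filter multiset_partition[symmetric])
    then show ?thesis
      unfolding r by simp
  qed
  have sub: "set (a # b # r) \<subseteq> {k \<in> set p. 1 < k}"
    unfolding r[symmetric] by auto
  then have "1 < a" "1 < b" "\<forall>k\<in>set ?q. 0 < k"
    using assms(1) by (auto simp: is_partition_def)
  then obtain E :: "(nat \<times> nat) set" and n where E: "sym E" "irrefl E" "E \<subseteq> {..<n} \<times> {..<n}"
    and n: "n = a + b + sum_list ?q"
    and neg: "Poly_Mapping.lookup (cpoly E {..<n}) (mset p) < 0"
    using negative_graph_exists[of a b ?q] unfolding p by blast
  let ?G = "\<lparr>pverts = {..<n}, parcs = E\<rparr>"
  have G: "pair_graph ?G"
    using E by (simp add: pair_graph_iff)
  have sum: "sum_list p = n"
    unfolding n using arg_cong[OF p, of sum_mset] by (simp add: sum_mset_sum_list del: mset_filter)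
  then have "e_coeff ?G p = Poly_Mapping.lookup (cpoly E {..<n}) (mset p)"
    using e_coeff_cpoly[OF G, of p] assms(1) by (simp add: partitions_of_def)
  then show ?thesis
    unfolding e_positive_def using neg G sum by (auto intro!: exI[of _ ?G])
qed

theorem theorem1p1:
  fixes p :: "nat list"
  assumes "is_partition p"
  shows "e_positive p \<longleftrightarrow> is_hook p"
  using assms hook_e_positive not_hook_not_e_positive by blast

end
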